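(* Let $\mathbb{K}$ be a field, $R=\mathbb{K}[x_1,\dots,x_n,y_1,\dots,y_n]$, $f_{ij}=x_iy_j-x_jy_i$, and $f=y_1\,f_{12}\,f_{23}\cdots f_{n-1\,n}\,x_n\in R$. Let $I\in\mathcal{C}_f$ be a Knutson ideal associated with $f$ and let $P\in\operatorname{Min}(I)$ be a minimal prime of $I$. Then there exist integers $k,l$ with $1\le k\le l+1\le n+1$ and subsets $U\subseteq\{1,\dots,k-1\}$, $V\subseteq\{l+1,\dots,n\}$ such that $$P=\Big((y_1,\dots,y_{k-1})+(x_u\mid u\in U)\Big)+L+\Big((x_{l+1},\dots,x_n)+(y_v\mid v\in V)\Big),$$ where $L$ is (the extension to $R$ of) an ideal of $\mathbb{K}[x_k,y_k,\dots,x_l,y_l]$ which is a minimal prime of the binomial edge ideal of a weakly closed graph and satisfies $L=\overline{L}$, and where each of the three summands may possibly be the zero ideal.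
   Context: Knutson ideals: let $f$ be a polynomial in a polynomial ring $A$ over $\mathbb{K}$ whose leading term is a squarefree monomial for some term order (for $A=R=\mathbb{K}[x_1,\dots,x_n,y_1,\dots,y_n]$, $f=y_1\,f_{12}\,f_{23}\cdots f_{n-1\,n}\,x_n$ with $f_{ij}=x_iy_j-x_jy_i$, and a diagonal term order, the leading monomial is $\prod_{i=1}^n x_iy_i$). $\mathcal{C}_f$ is the smallest set of ideals of $A$ such that: (1) $(f)\in\mathcal{C}_f$; (2) if $I\in\mathcal{C}_f$ then $I:J\in\mathcal{C}_f$ for every ideal $J\subseteq A$; (3) if $I,J\in\mathcal{C}_f$ then $I+J\in\mathcal{C}_f$ and $I\cap J\in\mathcal{C}_f$. Graphs $H$ are simple with vertex set a finite interval $W$ of integers; ideals generated in different polynomial rings in variables $x_i,y_i$ are compared by extending them to a common polynomial ring. The binomial edge ideal of $H$ is $J_H=(x_iy_j-x_jy_i\mid\{i,j\}\in E(H))$. $H$ is weakly closed if its vertices can be labeled so that for all $i<j<k$, $\{i,k\}\in E(H)$ implies $\{i,j\}\in E(H)$ or $\{j,k\}\in E(H)$. For $S\subseteq W$ let $H_1,\dots,H_{c}$ be the connected components of the restriction of $H$ to $W\setminus S$, let $\widetilde{H}_i$ be the complete graph on the vertices of $H_i$, and let $a_i,b_i$ be the smallest and largest vertices of $H_i$. Set $P_S(H)=(x_s,y_s\mid s\in S)+\sum_i J_{\widetilde{H}_i}$ and $\overline{P_S(H)}=(x_s,y_s\mid s\in S)+\sum_i I_2(X_{[a_i,b_i]})$,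 where $I_2(X_{[a,b]})$ is the ideal of $2$-minors of the $2\times(b-a+1)$ matrix with rows $(x_a,\dots,x_b)$ and $(y_a,\dots,y_b)$. Every minimal prime of $J_H$ is of the form $P_S(H)$. An ideal $L$ is said to satisfy $L=\overline{L}$ if $L=P_S(H)$ for some such $H$ and $S$ with $P_S(H)=\overline{P_S(H)}$; this depends only on the ideal $L$. *)

theory Defs
  imports "HOL-Library.Poly_Mapping" "HOL-Algebra.Ideal"
begin

section \<open>The polynomial rings $K[x_i, y_i \mid i \in W]$\<close>

text \<open>All polynomial rings live inside one type of polynomials in the variables
  $x_i, y_i$ with $i$ an integer; the ring attached to an index set \<open>W\<close> is the record whose
  carrier consists of the polynomials that involve only variables with index in \<open>W\<close>.\<close>

datatype var = VX int | VY int

fun var_index :: "var \<Rightarrow> int" where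
  "var_index (VX i) = i"
| "var_index (VY i) = i"

type_synonym 'k mpoly = "(var \<Rightarrow>\<^sub>0 nat) \<Rightarrow>\<^sub>0 'k"

definition poly_vars :: "'k::zero mpoly \<Rightarrow> var set" where
  "poly_vars p = (\<Union>m \<in> Poly_Mapping.keys p. Poly_Mapping.keys m)"

definition poly_ring :: "int set \<Rightarrow> ('k::field) mpoly ring" where
  "poly_ring W = \<lparr>carrier = {p. var_index ` poly_vars p \<subseteq> W},
     monoid.mult = (*), one = 1, ring.zero = 0, add = (+)\<rparr>"

definition xx :: "int \<Rightarrow> ('k::field) mpoly" where
  "xx i = Poly_Mapping.single (Poly_Mapping.single (VX i) 1) 1"

definition yy :: "int \<Rightarrow> ('k::field) mpoly" where
  "yy i = Poly_Mapping.single (Poly_Mapping.single (VY i) 1) 1"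

definition minor :: "int \<Rightarrow> int \<Rightarrow> ('k::field) mpoly" where
  "minor i j = xx i * yy j - xx j * yy i"

lemma poly_vars_add: "poly_vars (p + q) \<subseteq> poly_vars p \<union> poly_vars q"
  unfolding poly_vars_def using Poly_Mapping.keys_add[of p q] by blast

lemma poly_vars_mult:
  fixes p q :: "('k::field) mpoly"
  shows "poly_vars (p * q) \<subseteq> poly_vars p \<union> poly_vars q"
proof
  fix v assume "v \<in> poly_vars (p * q)"
  then obtain m where m: "m \<in> Poly_Mapping.keys (p * q)" "v \<in> Poly_Mapping.keys m"
    by (auto simp: poly_vars_def)
  then obtain a b where "m = a + b" "a \<in> Poly_Mapping.keys p" "b \<in> Poly_Mapping.keys q"
    using keys_mult[of p q] by blast
  with m(2) show "v \<in> poly_vars p \<union> poly_vars q"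
    using Poly_Mapping.keys_add[of a b] by (auto simp: poly_vars_def)
qed

lemma poly_vars_uminus: "poly_vars (- p) = poly_vars (p :: ('k::field) mpoly)"
  by (simp add: poly_vars_def)

lemma cring_poly_ring: "cring (poly_ring W :: ('k::field) mpoly ring)"
proof -
  let ?R = "poly_ring W :: 'k mpoly ring"
  have neg: "\<exists>q \<in> carrier ?R. p + q = 0" if "p \<in> carrier ?R" for p
    using that by (intro bexI[of _ "- p"]) (auto simp: poly_ring_def poly_vars_uminus)
  show ?thesis
  proof (intro cringI abelian_groupI comm_monoidI)
    show "x \<oplus>\<^bsub>?R\<^esub> y \<in> carrier ?R" if "x \<in> carrier ?R" "y \<in> carrier ?R" for x y
      using that poly_vars_add[of x y] unfolding poly_ring_def by fastforce
    show "x \<otimes>\<^bsub>?R\<^esub> y \<in> carrier ?R" if "x \<in> carrier ?R" "y \<in> carrier ?R" for x y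
      using that poly_vars_mult[of x y] unfolding poly_ring_def by fastforce
    show "\<exists>q \<in> carrier ?R. q \<oplus>\<^bsub>?R\<^esub> p = \<zero>\<^bsub>?R\<^esub>" if "p \<in> carrier ?R" for p
      using neg[OF that] by (auto simp: poly_ring_def add.commute)
  qed (auto simp: poly_ring_def poly_vars_def algebra_simps)
qed

lemma xx_yy_in_poly_ring: "i \<in> W \<Longrightarrow> xx i \<in> carrier (poly_ring W)"
  "i \<in> W \<Longrightarrow> yy i \<in> carrier (poly_ring W)"
  by (auto simp: poly_ring_def poly_vars_def xx_def yy_def)

text \<open>Equality of an ideal of $K[x_i,y_i \mid i\in A]$ and an ideal of
  $K[x_i,y_i \mid i\in B]$ after extension to a common polynomial ring.\<close>

definition same_ideal ::
  "int set \<Rightarrow> ('k::field) mpoly set \<Rightarrow> int set \<Rightarrow> 'k mpoly set \<Rightarrow> bool" where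
  "same_ideal A I B J \<longleftrightarrow>
     Idl\<^bsub>poly_ring (A \<union> B)\<^esub> I = Idl\<^bsub>poly_ring (A \<union> B)\<^esub> J"

section \<open>Minimal primes, colon ideals and Knutson ideals\<close>

definition minimal_primes :: "('a, 'm) ring_scheme \<Rightarrow> 'a set \<Rightarrow> 'a set set" where
  "minimal_primes R I = {P. primeideal P R \<and> I \<subseteq> P \<and>
     (\<forall>Q. primeideal Q R \<and> I \<subseteq> Q \<and> Q \<subseteq> P \<longrightarrow> Q = P)}"

definition colon_ideal :: "('a, 'm) ring_scheme \<Rightarrow> 'a set \<Rightarrow> 'a set \<Rightarrow> 'a set" where
  "colon_ideal R I J = {a \<in> carrier R. \<forall>b \<in> J. a \<otimes>\<^bsub>R\<^esub> b \<in> I}"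

inductive_set knutson_ideals :: "('a, 'm) ring_scheme \<Rightarrow> 'a \<Rightarrow> 'a set set"
  for R :: "('a, 'm) ring_scheme" and f :: 'a where
  principal: "Idl\<^bsub>R\<^esub> {f} \<in> knutson_ideals R f"
| colon: "\<lbrakk>I \<in> knutson_ideals R f; ideal J R\<rbrakk> \<Longrightarrow> colon_ideal R I J \<in> knutson_ideals R f"
| sum: "\<lbrakk>I \<in> knutson_ideals R f; J \<in> knutson_ideals R f\<rbrakk> \<Longrightarrow> I <+>\<^bsub>R\<^esub> J \<in> knutson_ideals R f"
| inter: "\<lbrakk>I \<in> knutson_ideals R f; J \<in> knutson_ideals R f\<rbrakk> \<Longrightarrow> I \<inter> J \<in> knutson_ideals R f"

definition knutson_f :: "int \<Rightarrow> ('k::field) mpoly" where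
  "knutson_f n = yy 1 * (\<Prod>i\<in>{1..<n}. minor i (i + 1)) * xx n"

section \<open>Graphs and binomial edge ideals\<close>

text \<open>A graph is a vertex set together with a set of two-element sets of vertices.\<close>

definition complete_edges :: "int set \<Rightarrow> int set set" where
  "complete_edges W = {e. e \<subseteq> W \<and> card e = 2}"

definition simple_graph :: "int set \<Rightarrow> int set set \<Rightarrow> bool" where
  "simple_graph W E \<longleftrightarrow> finite W \<and> E \<subseteq> complete_edges W"

definition weakly_closed :: "int set \<Rightarrow> int set set \<Rightarrow> bool" where
  "weakly_closed W E \<longleftrightarrow> (\<exists>lab. bij_betw lab W {1..card W} \<and>
     (\<forall>u\<in>W. \<forall>v\<in>W. \<forall>w\<in>W. lab u < lab v \<and> lab v < lab w \<and> {u, w} \<in> E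
        \<longrightarrow> {u, v} \<in> E \<or> {v, w} \<in> E))"

text \<open>Vertex sets of the connected components of the subgraph induced on \<open>A\<close>.\<close>

definition components_on :: "int set \<Rightarrow> int set set \<Rightarrow> int set set" where
  "components_on A E =
     A // {(u, v) \<in> A \<times> A. (u, v) \<in> {(u, v). u \<in> A \<and> v \<in> A \<and> {u, v} \<in> E}\<^sup>*}"

definition binomial_edge_ideal :: "int set \<Rightarrow> int set set \<Rightarrow> ('k::field) mpoly set" where
  "binomial_edge_ideal W E = Idl\<^bsub>poly_ring W\<^esub> {minor i j | i j. {i, j} \<in> E}"

text \<open>In \<open>poly_ring W\<close>: the ideal of 2-minors of the matrix with columns $a, \ldots, b$, for
  $\{a, \ldots, b\} \subseteq W$.\<close>

definition minors_ideal :: "int set \<Rightarrow> int \<Rightarrow> int \<Rightarrow> ('k::field) mpoly set" where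
  "minors_ideal W a b = Idl\<^bsub>poly_ring W\<^esub> {minor i j | i j. a \<le> i \<and> i < j \<and> j \<le> b}"

text \<open>The sums of ideals over all components are given as the ideals generated by the union
  of the summands.\<close>

definition P_ideal :: "int set \<Rightarrow> int set set \<Rightarrow> int set \<Rightarrow> ('k::field) mpoly set" where
  "P_ideal W E S = Idl\<^bsub>poly_ring W\<^esub> (xx ` S \<union> yy ` S \<union>
     (\<Union>C \<in> components_on (W - S) E. binomial_edge_ideal W (complete_edges C)))"

definition P_bar_ideal :: "int set \<Rightarrow> int set set \<Rightarrow> int set \<Rightarrow> ('k::field) mpoly set" where
  "P_bar_ideal W E S = Idl\<^bsub>poly_ring W\<^esub> (xx ` S \<union> yy ` S \<union>
     (\<Union>C \<in> components_on (W - S) E. minors_ideal W (Min C) (Max C)))"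

text \<open>The next two predicates concern an ideal \<open>L\<close> of \<open>poly_ring A\<close>. The vertex set of the
  graph is an arbitrary finite interval, not necessarily \<open>A\<close>: for instance the ideal
  $(x_2, y_2, x_1 y_3 - x_3 y_1)$ is a minimal prime of the binomial edge ideal of a graph on
  $\{1, \ldots, 4\}$, but of no graph on $\{1, 2, 3\}$.\<close>

definition min_prime_of_weakly_closed :: "int set \<Rightarrow> ('k::field) mpoly set \<Rightarrow> bool" where
  "min_prime_of_weakly_closed A L \<longleftrightarrow>
     (\<exists>a b E. simple_graph {a..b} E \<and> weakly_closed {a..b} E \<and>
        (\<exists>Q \<in> minimal_primes (poly_ring {a..b}) (binomial_edge_ideal {a..b} E).
           same_ideal A L {a..b} Q))"

definition equals_own_bar :: "int set \<Rightarrow> ('k::field) mpoly set \<Rightarrow> bool" where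
  "equals_own_bar A L \<longleftrightarrow>
     (\<exists>a b E S. simple_graph {a..b} E \<and> S \<subseteq> {a..b} \<and>
        same_ideal A L {a..b} (P_ideal {a..b} E S) \<and>
        (P_ideal {a..b} E S :: 'k mpoly set) = P_bar_ideal {a..b} E S)"

end

theory Submission
  imports Defs
begin

text \<open>Write $p_i = (x_i, y_i)$ for $1 \le i \le n$ and add the two constant points $p_0 = (1, 0)$
  and $p_{n+1} = (0, 1)$. With $F_{ij} = \det(p_i, p_j)$ one has $F_{0j} = y_j$ and
  $F_{i,n+1} = x_i$, hence $f = F_{01} F_{12} \cdots F_{n,n+1}$: the two variables in $f$ are minors
  like all the others. Given a set $S$ of indices and a nonempty set $D \subseteq \{0, \ldots, n\}$
  of cuts (a cut $g$ separates $g$ from $g + 1$), the cuts divide $0, \ldots, n+1$ into blocks of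
  consecutive indices. Let $P(S, D)$ be the ideal generated by $x_s, y_s$ for $s \in S$ and by all
  $F_{ij}$ with $i, j$ in one block. It is prime. The block of $0$ contributes variables $y_i$,
  the block of $n + 1$ variables $x_i$, and the blocks in between contribute 2-minors of consecutive
  columns; so $k - 1$ and $l$ are the first and the last cut, and $L$ is what happens
  between them (\<open>prime_of_decomposition\<close>).

  It therefore suffices that every Knutson ideal is an intersection of ideals $P(S, D)$, because
  a minimal prime of a finite intersection of primes is one of them
  (\<open>minimal_prime_prime_inter\<close>). The ideal $(f)$ is such an intersection since its factors
  generate the primes with just one uncut gap (\<open>principal_prime_inter\<close>). The class is
  trivially closed under intersection, and it is closed under colon because $P : J$ is $P$ or the
  whole ring for a prime $P$.

  Closure under sums (\<open>sum_prime_inter\<close>) is the heart of the proof. Each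
  monomial $m$ is straightened into a polynomial $b_m$: as long as $m$ is divisible by some
  $x_i y_j$ with $i < j$ and nothing from $m$ between $i$ and $j$, this factor is replaced by
  $F_{ij}$, where $0$ and $n+1$ count as positions of an invisible $x$ and $y$. Then $b_m$ is $m$
  plus monomials of smaller weight, where the weight counts each $y_j$ with multiplicity $j$.
  Call $m$ nonstandard for $(S, D)$ if it involves an index from $S$ or is divisible by some
  $x_i y_j$ with $i < j$ in one block, with the same convention for $0$ and $n + 1$. The point is that one and the same $b_m$ lies in
  every $P(S, D)$ for which $m$ is nonstandard (\<open>straightened_monomial\<close>), whereas the
  standard monomials are linearly independent modulo $P(S, D)$
  (\<open>param_inj_standard\<close>). So all $P(S, D)$ are described by monomials with respect to a common
  family $(b_m)$, and sums and intersections of them behave like unions and intersections of sets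
  of monomials. What remains is combinatorial: if $m$ is standard for two pairs, then
  it is standard for a third pair whose prime contains both (\<open>common_refinement\<close>).
  The argument works over every field.

  Finally, $L$ is a minimal prime of a binomial edge ideal of the graph on
  $\{k, \ldots, l + 2\}$ whose edges are all $\{i, j\}$ with $x_i y_j - x_j y_i \in L$ up to
  extension; the two additional vertices make every element of $S$ a cut vertex.\<close>

section \<open>Ideals of polynomial rings and linear extension of monomial maps\<close>

lemma poly_ring_simps [simp]:
  "mult (poly_ring W) = (*)" "one (poly_ring W) = 1" "ring.zero (poly_ring W) = 0" "add (poly_ring W) = (+)"
  by (simp_all add: poly_ring_def)

definition monomials :: "int set \<Rightarrow> (var \<Rightarrow>\<^sub>0 nat) set" where
  "monomials W = {m. var_index ` Poly_Mapping.keys m \<subseteq> W}"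

lemma carrier_iff: "p \<in> carrier (poly_ring W) \<longleftrightarrow> Poly_Mapping.keys p \<subseteq> monomials W"
  by (auto simp: poly_ring_def poly_vars_def monomials_def)

lemma sum_single_lookup:
  "(\<Sum>m\<in>Poly_Mapping.keys p. Poly_Mapping.single m (Poly_Mapping.lookup p m)) = p"
  by (rule poly_mapping_eqI)
    (auto simp: lookup_sum lookup_single when_def sum.delta in_keys_iff)

lemma keys_diff': "Poly_Mapping.keys (p - q) \<subseteq> Poly_Mapping.keys p \<union> Poly_Mapping.keys (q :: 'a \<Rightarrow>\<^sub>0 'k::ab_group_add)"
  by (auto simp: in_keys_iff lookup_minus)

lemma ideal_poly_ringI:
  assumes "J \<subseteq> carrier (poly_ring W)" "0 \<in> J" "\<And>p q. p \<in> J \<Longrightarrow> q \<in> J \<Longrightarrow> p + q \<in> J"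
    and "\<And>p q. p \<in> J \<Longrightarrow> q \<in> carrier (poly_ring W) \<Longrightarrow> q * p \<in> J"
  shows "ideal J (poly_ring W :: 'k::field mpoly ring)"
proof (rule idealI)
  show "ring (poly_ring W :: 'k mpoly ring)" by (rule cring.axioms(1)[OF cring_poly_ring])
  then interpret ring "poly_ring W :: 'k mpoly ring" .
  have minus: "- p \<in> J" if "p \<in> J" for p
  proof -
    have "- 1 \<in> carrier (poly_ring W :: 'k mpoly ring)"
      by (simp add: carrier_iff monomials_def)
    from assms(4)[OF that this] show ?thesis by simp
  qed
  have inv: "\<ominus>\<^bsub>poly_ring W\<^esub> p = - p" if "p \<in> J" for p
    using minus[OF that] that assms(1) by (intro minus_equality) auto
  show "subgroup J (add_monoid (poly_ring W :: 'k mpoly ring))"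
    using assms minus inv by (intro add.subgroupI) (auto simp: a_inv_def[symmetric])
next
  fix a x assume "a \<in> J" "x \<in> carrier (poly_ring W :: 'k mpoly ring)"
  then show "x \<otimes>\<^bsub>poly_ring W\<^esub> a \<in> J" "a \<otimes>\<^bsub>poly_ring W\<^esub> x \<in> J"
    using assms(4)[of a x] by (simp_all add: mult.commute)
qed

lemma ideal_poly_ringD:
  assumes "ideal J (poly_ring W :: 'k::field mpoly ring)"
  shows "J \<subseteq> carrier (poly_ring W)" "0 \<in> J" "p \<in> J \<Longrightarrow> q \<in> J \<Longrightarrow> p + q \<in> J"
    "p \<in> J \<Longrightarrow> q \<in> carrier (poly_ring W) \<Longrightarrow> q * p \<in> J"
    "p \<in> J \<Longrightarrow> q \<in> J \<Longrightarrow> p - q \<in> J"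
proof -
  interpret ideal J "poly_ring W :: 'k mpoly ring" by fact
  show "J \<subseteq> carrier (poly_ring W)" using a_subset by auto
  show "0 \<in> J" using additive_subgroup.zero_closed[OF additive_subgroup_axioms] by simp
  show add: "p \<in> J \<Longrightarrow> q \<in> J \<Longrightarrow> p + q \<in> J" for p q
    using additive_subgroup.a_closed[OF additive_subgroup_axioms, of p q] by simp
  show mult: "p \<in> J \<Longrightarrow> q \<in> carrier (poly_ring W) \<Longrightarrow> q * p \<in> J" for p q using I_l_closed by simp
  have "- 1 \<in> carrier (poly_ring W :: 'k mpoly ring)"
    by (simp add: carrier_iff monomials_def)
  from mult[OF _ this] have "- q \<in> J" if "q \<in> J" for q using that by auto
  then show "p \<in> J \<Longrightarrow> q \<in> J \<Longrightarrow> p - q \<in> J" using add[of p "- q"] by auto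
qed

lemma carrier_poly_ring_closed:
  shows "p \<in> carrier (poly_ring W) \<Longrightarrow> q \<in> carrier (poly_ring W) \<Longrightarrow> p + q \<in> carrier (poly_ring W)"
    "p \<in> carrier (poly_ring W) \<Longrightarrow> q \<in> carrier (poly_ring W) \<Longrightarrow> p * q \<in> carrier (poly_ring W)"
    "p \<in> carrier (poly_ring W) \<Longrightarrow> q \<in> carrier (poly_ring W) \<Longrightarrow> p - q \<in> carrier (poly_ring W)"
    "0 \<in> carrier (poly_ring W)" "1 \<in> carrier (poly_ring W)"
proof -
  interpret cring "poly_ring W" by (rule cring_poly_ring)
  show "p \<in> carrier (poly_ring W) \<Longrightarrow> q \<in> carrier (poly_ring W) \<Longrightarrow> p + q \<in> carrier (poly_ring W)"
    using a_closed by simp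
  show "p \<in> carrier (poly_ring W) \<Longrightarrow> q \<in> carrier (poly_ring W) \<Longrightarrow> p * q \<in> carrier (poly_ring W)"
    using m_closed by simp
  show "p \<in> carrier (poly_ring W) \<Longrightarrow> q \<in> carrier (poly_ring W) \<Longrightarrow> p - q \<in> carrier (poly_ring W)"
    by (rule ideal_poly_ringD(5)[OF oneideal])
  show "0 \<in> carrier (poly_ring W)" "1 \<in> carrier (poly_ring W)"
    using zero_closed one_closed by simp_all
qed

definition linear_extension :: "('a \<Rightarrow> ('b::monoid_add \<Rightarrow>\<^sub>0 'k::comm_ring_1)) \<Rightarrow> ('a \<Rightarrow>\<^sub>0 'k) \<Rightarrow> ('b \<Rightarrow>\<^sub>0 'k)" where
  "linear_extension \<psi> p = (\<Sum>m\<in>Poly_Mapping.keys p. Poly_Mapping.single 0 (Poly_Mapping.lookup p m) * \<psi> m)"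

lemma linear_extension_superset:
  assumes "finite A" "Poly_Mapping.keys p \<subseteq> A"
  shows "linear_extension \<psi> p = (\<Sum>m\<in>A. Poly_Mapping.single 0 (Poly_Mapping.lookup p m) * \<psi> m)"
  unfolding linear_extension_def using assms
  by (intro sum.mono_neutral_left) (auto simp: in_keys_iff)

lemma linear_extension_0 [simp]: "linear_extension \<psi> 0 = 0"
  by (simp add: linear_extension_def)

lemma linear_extension_add: "linear_extension \<psi> (p + q) = linear_extension \<psi> p + linear_extension \<psi> q"
proof -
  let ?A = "Poly_Mapping.keys p \<union> Poly_Mapping.keys q"
  have "Poly_Mapping.keys (p + q) \<subseteq> ?A" by (rule Poly_Mapping.keys_add)
  then show ?thesis
    by (simp add: linear_extension_superset[of ?A] lookup_add single_add distrib_right sum.distrib)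
qed

lemma linear_extension_sum: "linear_extension \<psi> (\<Sum>i\<in>A. f i) = (\<Sum>i\<in>A. linear_extension \<psi> (f i))"
  by (induction A rule: infinite_finite_induct) (auto simp: linear_extension_add)

lemma linear_extension_single: "linear_extension \<psi> (Poly_Mapping.single m c) = Poly_Mapping.single 0 c * \<psi> m"
  by (simp add: linear_extension_superset[of "{m}"])

lemma linear_extension_uminus: "linear_extension \<psi> (- p) = - linear_extension \<psi> p"
  using linear_extension_add[of \<psi> p "- p"] by (simp add: eq_neg_iff_add_eq_0 add.commute)

lemma linear_extension_minus: "linear_extension \<psi> (p - q) = linear_extension \<psi> p - linear_extension \<psi> q"
  using linear_extension_add[of \<psi> p "- q"] by (simp add: linear_extension_uminus)

lemma linear_extension_mult:
  fixes \<psi> :: "'a::comm_monoid_add \<Rightarrow> ('b::comm_monoid_add \<Rightarrow>\<^sub>0 'k::comm_ring_1)"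
  assumes mult: "\<And>m m'. \<psi> (m + m') = \<psi> m * \<psi> m'"
  shows "linear_extension \<psi> (p * q) = linear_extension \<psi> p * linear_extension \<psi> q"
proof -
  have "p * q = (\<Sum>m\<in>Poly_Mapping.keys p. \<Sum>m'\<in>Poly_Mapping.keys q.
      Poly_Mapping.single m (Poly_Mapping.lookup p m) * Poly_Mapping.single m' (Poly_Mapping.lookup q m'))"
    using sum_product[of "\<lambda>m. Poly_Mapping.single m (Poly_Mapping.lookup p m)" "Poly_Mapping.keys p"
      "\<lambda>m. Poly_Mapping.single m (Poly_Mapping.lookup q m)" "Poly_Mapping.keys q"]
    by (simp add: sum_single_lookup)
  also have "linear_extension \<psi> \<dots> = (\<Sum>m\<in>Poly_Mapping.keys p. \<Sum>m'\<in>Poly_Mapping.keys q.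
      (Poly_Mapping.single 0 (Poly_Mapping.lookup p m) * \<psi> m) *
      (Poly_Mapping.single 0 (Poly_Mapping.lookup q m') * \<psi> m'))"
    by (simp add: linear_extension_sum mult_single linear_extension_single mult)
      (intro sum.cong refl, simp add: mult_single[of 0 _ 0 _, simplified, symmetric] ac_simps)
  also have "\<dots> = linear_extension \<psi> p * linear_extension \<psi> q"
    by (simp add: linear_extension_def sum_product)
  finally show ?thesis .
qed

section \<open>The monomial parametrisation of a block prime\<close>

text \<open>The number of cuts to the left of \<open>i\<close> labels the block of \<open>i\<close>.\<close>

definition block :: "int set \<Rightarrow> int \<Rightarrow> nat" where
  "block D i = card (D \<inter> {0..<i})"

text \<open>Besides the variables with index in \<open>S\<close>, the parametrisation must annihilate
  the $y_i$ in the block of $0$ and the $x_i$ in the block of $n + 1$, as $p_i$ is parallel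
  to $(1,0)$, respectively to $(0,1)$, there.\<close>

definition killed_vars :: "int \<Rightarrow> int set \<Rightarrow> int set \<Rightarrow> var set" where
  "killed_vars n S D = {VX i | i. i \<in> S \<or> D \<inter> {i..n} = {}} \<union> {VY i | i. i \<in> S \<or> D \<inter> {0..<i} = {}}"

text \<open>Points in one block are parallel, so a generic choice is $p_i = t_i \cdot (1, q_c)$, where
  $c$ is the label of the block of $i$. This is the exponent of the image of
  \<open>m\<close> under $x_i \mapsto t_i$, $y_i \mapsto t_i q_c$; the variable $t_i$
  carries the positive number $i$ and $q_c$ the nonpositive number $-c$. Dehomogenising the
  direction vector loses nothing, since the exponents of the $t_i$ record the degree.\<close>

definition image_expo :: "int \<Rightarrow> int set \<Rightarrow> (var \<Rightarrow>\<^sub>0 nat) \<Rightarrow> (int \<Rightarrow>\<^sub>0 nat)" where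
  "image_expo n D m = (\<Sum>i\<in>{1..n}.
     Poly_Mapping.single i (Poly_Mapping.lookup m (VX i) + Poly_Mapping.lookup m (VY i)) +
     Poly_Mapping.single (- int (block D i)) (Poly_Mapping.lookup m (VY i)))"

definition mono_map :: "int \<Rightarrow> int set \<Rightarrow> int set \<Rightarrow> (var \<Rightarrow>\<^sub>0 nat) \<Rightarrow> ((int \<Rightarrow>\<^sub>0 nat) \<Rightarrow>\<^sub>0 'k::field)" where
  "mono_map n S D m = (if Poly_Mapping.keys m \<inter> killed_vars n S D = {} then Poly_Mapping.single (image_expo n D m) 1 else 0)"

abbreviation param :: "int \<Rightarrow> int set \<Rightarrow> int set \<Rightarrow> 'k::field mpoly \<Rightarrow> ((int \<Rightarrow>\<^sub>0 nat) \<Rightarrow>\<^sub>0 'k)" where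
  "param n S D \<equiv> linear_extension (mono_map n S D)"

lemma keys_add_mono: "Poly_Mapping.keys (m + m') = Poly_Mapping.keys m \<union> Poly_Mapping.keys (m' :: 'a \<Rightarrow>\<^sub>0 nat)"
  by (auto simp: in_keys_iff lookup_add)

lemma image_expo_add: "image_expo n D (m + m') = image_expo n D m + image_expo n D m'"
  unfolding image_expo_def lookup_add single_add sum.distrib[symmetric]
  by (intro sum.cong refl) (simp add: ac_simps)

lemma mono_map_add: "mono_map n S D (m + m') = mono_map n S D m * mono_map n S D m'"
  by (auto simp: mono_map_def keys_add_mono image_expo_add mult_single)

lemma mono_map_0 [simp]: "mono_map n S D 0 = 1"
  by (simp add: mono_map_def image_expo_def)

lemma param_mult: "param n S D (p * q) = param n S D p * param n S D q"
  by (rule linear_extension_mult) (rule mono_map_add)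

lemma param_1 [simp]: "param n S D 1 = 1"
  using linear_extension_single[of "mono_map n S D" 0 1] by simp

text \<open>The ideal $P(S, D)$ in the variables with index in \<open>W\<close>. Defining it as a kernel
  makes primality immediate; that it is generated by the variables and minors in question is
  \<open>block_prime_least\<close>.\<close>

definition block_prime :: "int set \<Rightarrow> int \<Rightarrow> int set \<Rightarrow> int set \<Rightarrow> 'k::field mpoly set" where
  "block_prime W n S D = {p \<in> carrier (poly_ring W). param n S D p = 0}"

text \<open>The target of the parametrisation is a polynomial ring over a field, hence a domain.\<close>

lemma primeideal_block_prime: "primeideal (block_prime W n S D) (poly_ring W :: 'k::field mpoly ring)"
proof (rule primeidealI)
  show "ideal (block_prime W n S D) (poly_ring W :: 'k mpoly ring)"
    by (rule ideal_poly_ringI)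
      (auto simp: block_prime_def carrier_poly_ring_closed linear_extension_add param_mult)
  show "cring (poly_ring W :: 'k mpoly ring)" by (rule cring_poly_ring)
  have "(1 :: 'k mpoly) \<in> carrier (poly_ring W)" "1 \<notin> block_prime W n S D"
    by (auto simp: block_prime_def carrier_poly_ring_closed)
  then show "carrier (poly_ring W :: 'k mpoly ring) \<noteq> block_prime W n S D" by blast
  show "a \<in> block_prime W n S D \<or> b \<in> block_prime W n S D"
    if "a \<in> carrier (poly_ring W)" "b \<in> carrier (poly_ring W)"
      "a \<otimes>\<^bsub>poly_ring W\<^esub> b \<in> block_prime W n S D" for a b :: "'k mpoly"
    using that by (auto simp: block_prime_def param_mult)
qed

lemmas ideal_block_prime = primeideal.axioms(1)[OF primeideal_block_prime]

section \<open>Standard monomials and straightening\<close>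

text \<open>The coordinates of $p_0, \ldots, p_{n+1}$.\<close>

definition ext_x :: "int \<Rightarrow> int \<Rightarrow> 'k::field mpoly" where
  "ext_x n i = (if i = 0 then 1 else if i = n + 1 then 0 else xx i)"

definition ext_y :: "int \<Rightarrow> int \<Rightarrow> 'k::field mpoly" where
  "ext_y n i = (if i = 0 then 0 else if i = n + 1 then 1 else yy i)"

definition ext_minor :: "int \<Rightarrow> int \<Rightarrow> int \<Rightarrow> 'k::field mpoly" where
  "ext_minor n i j = ext_x n i * ext_y n j - ext_x n j * ext_y n i"

text \<open>The generators of $P(S, D)$ lie in the ideal \<open>J\<close>. A minor that involves an
  index from \<open>S\<close> is a combination of the variables with that index and is left
  out (\<open>ext_minor_killed\<close>).\<close>

definition contains_gens :: "int set \<Rightarrow> int \<Rightarrow> int set \<Rightarrow> int set \<Rightarrow> 'k::field mpoly set \<Rightarrow> bool" where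
  "contains_gens W n S D J \<longleftrightarrow> ideal J (poly_ring W) \<and> (\<forall>s\<in>S \<inter> W. xx s \<in> J \<and> yy s \<in> J) \<and>
     (\<forall>i\<in>insert 0 (W - S). \<forall>j\<in>insert (n + 1) (W - S).
        i < j \<longrightarrow> D \<inter> {i..<j} = {} \<longrightarrow> ext_minor n i j \<in> J)"

text \<open>The constant point $p_0 = (1, 0)$ has $x$-coordinate $1$, so every monomial counts as
  divisible by $x_0$, and likewise by $y_{n+1}$. With this convention the blocks of $0$ and
  $n + 1$ follow the same rule as the other ones.\<close>

definition xsupp :: "(var \<Rightarrow>\<^sub>0 nat) \<Rightarrow> int set" where
  "xsupp m = insert 0 {i. VX i \<in> Poly_Mapping.keys m}"

definition ysupp :: "int \<Rightarrow> (var \<Rightarrow>\<^sub>0 nat) \<Rightarrow> int set" where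
  "ysupp n m = insert (n + 1) {j. VY j \<in> Poly_Mapping.keys m}"

definition standard :: "int \<Rightarrow> int set \<Rightarrow> int set \<Rightarrow> (var \<Rightarrow>\<^sub>0 nat) \<Rightarrow> bool" where
  "standard n S D m \<longleftrightarrow>
     (\<forall>s\<in>S. VX s \<notin> Poly_Mapping.keys m \<and> VY s \<notin> Poly_Mapping.keys m) \<and>
     (\<forall>i\<in>xsupp m. \<forall>j\<in>ysupp n m. i < j \<longrightarrow> D \<inter> {i..<j} \<noteq> {})"

text \<open>This weight makes $x_i y_j$ the leading term of $F_{ij}$ for $i < j$. It is not a total
  order on monomials, but being a natural number it supports induction directly.\<close>

definition weight :: "int \<Rightarrow> (var \<Rightarrow>\<^sub>0 nat) \<Rightarrow> nat" where
  "weight n m = (\<Sum>i\<in>{1..n}. nat i * Poly_Mapping.lookup m (VY i))"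

definition var_degree :: "int \<Rightarrow> (var \<Rightarrow>\<^sub>0 nat) \<Rightarrow> nat" where
  "var_degree n m = (\<Sum>i\<in>{1..n}. Poly_Mapping.lookup m (VX i) + Poly_Mapping.lookup m (VY i))"

definition low_weight :: "int \<Rightarrow> nat \<Rightarrow> 'k::field mpoly set" where
  "low_weight n k = {q. \<forall>m\<in>Poly_Mapping.keys q. weight n m < k}"

lemma weight_add: "weight n (m + m') = weight n m + weight n m'"
  by (simp add: weight_def lookup_add distrib_left sum.distrib)

lemma var_degree_add: "var_degree n (m + m') = var_degree n m + var_degree n m'"
  by (simp add: var_degree_def lookup_add sum.distrib)

lemma weight_single_VX [simp]: "weight n (Poly_Mapping.single (VX i) c) = 0"
  by (simp add: weight_def lookup_single when_def)

lemma weight_single_VY: "i \<in> {1..n} \<Longrightarrow> weight n (Poly_Mapping.single (VY i) c) = nat i * c"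
  by (simp add: weight_def lookup_single when_def sum.delta if_distrib cong: if_cong)

lemma var_degree_single_VX: "i \<in> {1..n} \<Longrightarrow> var_degree n (Poly_Mapping.single (VX i) c) = c"
  by (simp add: var_degree_def lookup_single when_def sum.delta cong: if_cong)

lemma var_degree_single_VY: "i \<in> {1..n} \<Longrightarrow> var_degree n (Poly_Mapping.single (VY i) c) = c"
  by (simp add: var_degree_def lookup_single when_def sum.delta cong: if_cong)

lemma low_weight_add: "p \<in> low_weight n k \<Longrightarrow> q \<in> low_weight n k \<Longrightarrow> p + q \<in> low_weight n k"
  using Poly_Mapping.keys_add[of p q] by (auto simp: low_weight_def)

lemma low_weight_minus: "p \<in> low_weight n k \<Longrightarrow> q \<in> low_weight n k \<Longrightarrow> p - q \<in> low_weight n k"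
  using keys_diff'[of p q] by (auto simp: low_weight_def)

lemma low_weight_0 [simp]: "0 \<in> low_weight n k" by (simp add: low_weight_def)

lemma low_weight_uminus: "q \<in> low_weight n k \<Longrightarrow> - q \<in> low_weight n k"
  using low_weight_minus[of 0 n k q] by simp

lemma low_weight_sum: "(\<And>i. i \<in> A \<Longrightarrow> f i \<in> low_weight n k) \<Longrightarrow> (\<Sum>i\<in>A. f i) \<in> low_weight n k"
  by (induction A rule: infinite_finite_induct) (auto intro: low_weight_add)

lemma low_weight_mono: "p \<in> low_weight n k \<Longrightarrow> k \<le> k' \<Longrightarrow> p \<in> low_weight n k'"
  by (auto simp: low_weight_def intro: less_le_trans)

lemma low_weight_single_mult: "q \<in> low_weight n k \<Longrightarrow> Poly_Mapping.single m c * q \<in> low_weight n (weight n m + k)"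
  using keys_mult[of "Poly_Mapping.single m c" q]
  by (auto simp: low_weight_def weight_add split: if_splits)

lemma low_weight_single: "weight n m < k \<Longrightarrow> Poly_Mapping.single m c \<in> low_weight n k"
  by (simp add: low_weight_def)

lemma single_carrier: "m \<in> monomials W \<Longrightarrow> Poly_Mapping.single m c \<in> carrier (poly_ring W)"
  by (simp add: carrier_iff)

lemma ext_x_carrier: "i \<in> insert 0 (insert (n + 1) W) \<Longrightarrow> ext_x n i \<in> carrier (poly_ring W)"
  by (auto simp: ext_x_def carrier_poly_ring_closed xx_yy_in_poly_ring)

lemma ext_y_carrier: "i \<in> insert 0 (insert (n + 1) W) \<Longrightarrow> ext_y n i \<in> carrier (poly_ring W)"
  by (auto simp: ext_y_def carrier_poly_ring_closed xx_yy_in_poly_ring)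

lemma ext_minor_carrier:
  "i \<in> insert 0 (insert (n + 1) W) \<Longrightarrow> j \<in> insert 0 (insert (n + 1) W) \<Longrightarrow> ext_minor n i j \<in> carrier (poly_ring W)"
  unfolding ext_minor_def by (intro carrier_poly_ring_closed ext_x_carrier ext_y_carrier)

lemma ext_x_ext_y_inner: "W \<subseteq> {1..n} \<Longrightarrow> i \<in> W \<Longrightarrow> ext_x n i = xx i \<and> ext_y n i = yy i"
  by (force simp: ext_x_def ext_y_def)

lemma ext_minor_inner: "W \<subseteq> {1..n} \<Longrightarrow> i \<in> W \<Longrightarrow> j \<in> W \<Longrightarrow> ext_minor n i j = minor i j"
  by (simp add: ext_minor_def minor_def ext_x_ext_y_inner)

lemma ext_minor_killed:
  assumes W: "W \<subseteq> {1..n}" and J: "ideal J (poly_ring W)" "\<forall>s\<in>S \<inter> W. xx s \<in> J \<and> yy s \<in> J"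
    and ij: "i \<in> insert 0 (insert (n + 1) W)" "j \<in> insert 0 (insert (n + 1) W)"
      "i \<in> S \<inter> W \<or> j \<in> S \<inter> W"
  shows "ext_minor n i j \<in> J"
proof -
  have c: "ext_x n t \<in> J \<and> ext_y n t \<in> J" if "t \<in> S \<inter> W" for t
    using that J(2) by (simp add: ext_x_ext_y_inner[OF W])
  note mult = ideal_poly_ringD(4)[OF J(1)]
  note minus = ideal_poly_ringD(5)[OF J(1)]
  from ij(3) show ?thesis
  proof
    assume "i \<in> S \<inter> W"
    with c have "ext_y n j * ext_x n i \<in> J" "ext_x n j * ext_y n i \<in> J"
      using ij(2) by (auto intro!: mult ext_x_carrier ext_y_carrier)
    from minus[OF this] show ?thesis by (simp add: ext_minor_def mult.commute)
  next
    assume "j \<in> S \<inter> W"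
    with c have "ext_x n i * ext_y n j \<in> J" "ext_y n i * ext_x n j \<in> J"
      using ij(1) by (auto intro!: mult ext_x_carrier ext_y_carrier)
    from minus[OF this] show ?thesis by (simp add: ext_minor_def mult.commute)
  qed
qed

lemma contains_gens_ext_minor:
  assumes "W \<subseteq> {1..n}" "contains_gens W n S D J" "i \<in> insert 0 W" "j \<in> insert (n + 1) W" "i < j" "D \<inter> {i..<j} = {}"
  shows "ext_minor n i j \<in> J"
proof (cases "i \<in> S \<inter> W \<or> j \<in> S \<inter> W")
  case True
  then show ?thesis using assms ext_minor_killed[of W n J S i j] by (auto simp: contains_gens_def)
next
  case False
  then show ?thesis using assms by (auto simp: contains_gens_def)
qed

text \<open>Take a pair of minimal distance in the given interval: an element of \<open>A\<close> or
  \<open>B\<close> strictly between its members would form a closer pair with one of them.\<close>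

lemma adjacent_pair:
  fixes A B :: "int set"
  assumes "i0 \<in> A" "j0 \<in> B" "i0 < j0"
  obtains i j where "i \<in> A" "j \<in> B" "i < j" "i0 \<le> i" "j \<le> j0"
    "\<And>u. u \<in> A \<Longrightarrow> i0 \<le> u \<Longrightarrow> u < j \<Longrightarrow> u \<le> i" "\<And>v. v \<in> B \<Longrightarrow> v \<le> j0 \<Longrightarrow> i < v \<Longrightarrow> j \<le> v"
proof -
  define Q where "Q = (\<lambda>(i,j). i \<in> A \<and> j \<in> B \<and> i < j \<and> i0 \<le> i \<and> j \<le> j0)"
  have "Q (i0, j0)" using assms by (simp add: Q_def)
  from ex_has_least_nat[of Q, OF this, of "\<lambda>(i,j). nat (j - i)"]
  obtain p where p: "Q p" and "\<forall>q. Q q \<longrightarrow> (case p of (i,j) \<Rightarrow> nat (j - i)) \<le> (case q of (i,j) \<Rightarrow> nat (j - i))"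
    by blast
  moreover obtain i j where "p = (i, j)" by (cases p)
  ultimately have ij: "Q (i, j)" and min: "\<And>u v. Q (u, v) \<Longrightarrow> nat (j - i) \<le> nat (v - u)" by auto
  show thesis
  proof (rule that[of i j])
    show "u \<le> i" if "u \<in> A" "i0 \<le> u" "u < j" for u
      using min[of u j] ij that by (force simp: Q_def)
    show "j \<le> v" if "v \<in> B" "v \<le> j0" "i < v" for v
      using min[of i v] ij that by (force simp: Q_def)
  qed (use ij in \<open>auto simp: Q_def\<close>)
qed

lemma factor_out_variable:
  assumes "v \<in> Poly_Mapping.keys (m :: 'a \<Rightarrow>\<^sub>0 nat)"
  shows "\<exists>m'. m = Poly_Mapping.single v 1 + m'"
proof
  show "m = Poly_Mapping.single v 1 + (m - Poly_Mapping.single v 1)"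
    using assms by (intro poly_mapping_eqI) (auto simp: lookup_add lookup_minus lookup_single when_def in_keys_iff)
qed

text \<open>The polynomial $b_m$. Take $i < j$ of minimal distance with $x_i$ and $y_j$ dividing $m$ and
  set $b_m = F_{ij} \, b_{m'}$ with $m' = m / (x_i y_j)$. If $m$ is nonstandard for $(S,
  D)$, then either $F_{ij}$ already lies in $P(S, D)$, or the reason for being nonstandard
  survives in $m'$: a witness $x_u y_v$ with $u = i$ would have $v \ge j$ by minimality, and
  then $i, j$ would be in one block as well. The choice of $i, j$ does not depend on $(S,
  D)$, which is why one $b_m$ serves all of them.\<close>

lemma straightened_monomial:
  fixes W :: "int set"
  assumes W: "W \<subseteq> {1..n}" and n: "0 \<le> n" and m: "m \<in> monomials W"
  shows "\<exists>b \<in> carrier (poly_ring W :: 'k::field mpoly ring).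
    b - Poly_Mapping.single m 1 \<in> low_weight n (weight n m) \<and>
    (\<forall>S D J. contains_gens W n S D J \<longrightarrow> \<not> standard n S D m \<longrightarrow> b \<in> J)"
  using m
proof (induction "var_degree n m" arbitrary: m rule: less_induct)
  case less
  have keysW: "\<And>i. VX i \<in> Poly_Mapping.keys m \<Longrightarrow> i \<in> W" "\<And>i. VY i \<in> Poly_Mapping.keys m \<Longrightarrow> i \<in> W"
    using less.prems by (force simp: monomials_def)+
  show ?case
  proof (cases "m = 0")
    case True
    have "(1 :: 'k mpoly) \<in> J" if "contains_gens W n S D J" "\<not> standard n S D m" for S D J
    proof -
      have "D \<inter> {0..<n + 1} = {}"
        using that(2) n True by (auto simp: standard_def xsupp_def ysupp_def)
      then have "(ext_minor n 0 (n + 1) :: 'k mpoly) \<in> J"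
        using contains_gens_ext_minor[OF W that(1), of 0 "n + 1"] n by auto
      then show ?thesis using n by (simp add: ext_minor_def ext_x_def ext_y_def)
    qed
    then show ?thesis using True
      by (intro bexI[of _ 1]) (auto simp: single_carrier monomials_def single_one[symmetric] simp del: single_one)
  next
    case False
    have "0 \<in> xsupp m" "n + 1 \<in> ysupp n m" "0 < n + 1" using n by (auto simp: xsupp_def ysupp_def)
    from adjacent_pair[OF this] obtain i j where i: "i \<in> xsupp m" and j: "j \<in> ysupp n m" and "i < j"
      and "0 \<le> i" "j \<le> n + 1"
      and mini: "\<And>u. u \<in> xsupp m \<Longrightarrow> 0 \<le> u \<Longrightarrow> u < j \<Longrightarrow> u \<le> i"
      and minj: "\<And>v. v \<in> ysupp n m \<Longrightarrow> v \<le> n + 1 \<Longrightarrow> i < v \<Longrightarrow> j \<le> v" by metis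
    have xs: "0 \<le> u" "u < n + 1" if "u \<in> xsupp m" for u
      using that keysW W n by (force simp: xsupp_def)+
    have ys: "0 < v" "v \<le> n + 1" if "v \<in> ysupp n m" for v
      using that keysW W n by (force simp: ysupp_def)+
    have iW: "i \<in> insert 0 W" and jW: "j \<in> insert (n + 1) W"
      using i j keysW by (auto simp: xsupp_def ysupp_def)
    have nontriv: "i \<noteq> 0 \<or> j \<noteq> n + 1"
    proof (rule ccontr)
      assume *: "\<not> ?thesis"
      have "VX u \<notin> Poly_Mapping.keys m" for u
        using mini[of u] xs[of u] keysW(1)[of u] W * by (force simp: xsupp_def)
      moreover have "VY u \<notin> Poly_Mapping.keys m" for u
        using minj[of u] ys[of u] keysW(2)[of u] W * by (force simp: ysupp_def)
      ultimately have "Poly_Mapping.keys m = {}" by (metis equals0I var.exhaust)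
      with False show False by simp
    qed
    define a where "a = (if i = 0 then 0 else Poly_Mapping.single (VX i) (1::nat))"
    define c where "c = (if j = n + 1 then 0 else Poly_Mapping.single (VY j) (1::nat))"
    have "\<exists>m1. m = a + m1"
    proof (cases "i = 0")
      case False
      then show ?thesis using i factor_out_variable[of "VX i" m] by (simp add: a_def xsupp_def)
    qed (simp add: a_def)
    then obtain m1 where m1: "m = a + m1" by blast
    have "VY j \<in> Poly_Mapping.keys m1" if "j \<noteq> n + 1"
      using j that m1 by (auto simp: ysupp_def a_def keys_add_mono split: if_splits)
    then have "\<exists>m'. m1 = c + m'"
      using factor_out_variable[of "VY j" m1] by (cases "j = n + 1") (simp_all add: c_def)
    then obtain m' where m': "m = a + c + m'" using m1 by (auto simp: add.assoc)
    have keys_m: "Poly_Mapping.keys m = Poly_Mapping.keys a \<union> Poly_Mapping.keys c \<union> Poly_Mapping.keys m'"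
      by (simp add: m' keys_add_mono)
    have iW': "i \<noteq> 0 \<Longrightarrow> i \<in> {1..n}" and jW': "j \<noteq> n + 1 \<Longrightarrow> j \<in> {1..n}"
      using iW jW W by auto
    have "var_degree n m' < var_degree n m"
      using nontriv iW' jW' by (auto simp: m' var_degree_add a_def c_def var_degree_single_VX var_degree_single_VY)
    moreover have "m' \<in> monomials W" using less.prems keys_m by (auto simp: monomials_def)
    ultimately obtain b where b: "b \<in> carrier (poly_ring W :: 'k mpoly ring)"
      "b - Poly_Mapping.single m' 1 \<in> low_weight n (weight n m')"
      and bJ: "\<And>S D J. contains_gens W n S D J \<Longrightarrow> \<not> standard n S D m' \<Longrightarrow> b \<in> J"
      using less.hyps by blast
    have hm: "ext_minor n i j = (Poly_Mapping.single (a + c) 1 :: 'k mpoly) - ext_x n j * ext_y n i"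
      using \<open>i < j\<close> \<open>0 \<le> i\<close> \<open>j \<le> n + 1\<close>
      by (auto simp: ext_minor_def ext_x_def ext_y_def a_def c_def xx_def yy_def mult_single single_one[symmetric] simp del: single_one)
    have "ext_minor n i j * b - Poly_Mapping.single m 1 =
        Poly_Mapping.single (a + c) 1 * (b - Poly_Mapping.single m' 1) - ext_x n j * ext_y n i * b"
      by (simp add: hm m' left_diff_distrib right_diff_distrib mult_single)
    moreover have "Poly_Mapping.single (a + c) 1 * (b - Poly_Mapping.single m' 1) \<in> low_weight n (weight n m)"
      using low_weight_single_mult[OF b(2), of "a + c" 1] by (simp add: m' weight_add add.assoc)
    moreover have "ext_x n j * ext_y n i * b \<in> low_weight n (weight n m)"
    proof (cases "i = 0 \<or> j = n + 1")
      case True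
      then show ?thesis using n by (auto simp: ext_x_def ext_y_def)
    next
      case False
      let ?d = "Poly_Mapping.single (VX j) 1 + Poly_Mapping.single (VY i) (1::nat)"
      have "ext_x n j * ext_y n i = (Poly_Mapping.single ?d 1 :: 'k mpoly)"
        using False \<open>i < j\<close> \<open>0 \<le> i\<close> \<open>j \<le> n + 1\<close> by (auto simp: ext_x_def ext_y_def xx_def yy_def mult_single)
      moreover have "b \<in> low_weight n (weight n m' + 1)"
        using low_weight_add[OF low_weight_mono[OF b(2), of "weight n m' + 1"] low_weight_single[of n m' "weight n m' + 1" 1]] by simp
      ultimately have "ext_x n j * ext_y n i * b \<in> low_weight n (weight n ?d + (weight n m' + 1))"
        by (simp only: low_weight_single_mult)
      moreover have "weight n ?d + (weight n m' + 1) \<le> weight n m"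
        using False iW' jW' \<open>i < j\<close> by (simp add: m' weight_add a_def c_def weight_single_VY)
      ultimately show ?thesis by (rule low_weight_mono)
    qed
    ultimately have "ext_minor n i j * b - Poly_Mapping.single m 1 \<in> low_weight n (weight n m)"
      by (simp add: low_weight_minus)
    moreover have "ext_minor n i j * b \<in> carrier (poly_ring W)"
      using iW jW b(1) by (intro carrier_poly_ring_closed(2) ext_minor_carrier) auto
    moreover have "ext_minor n i j * b \<in> J" if g: "contains_gens W n S D J" and ns: "\<not> standard n S D m" for S D J
    proof -
      have J: "ideal J (poly_ring W)" and JS: "\<forall>s\<in>S \<inter> W. xx s \<in> J \<and> yy s \<in> J"
        using g by (auto simp: contains_gens_def)
      have hc: "ext_minor n i j \<in> carrier (poly_ring W)"
        using iW jW by (intro ext_minor_carrier) auto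
      show ?thesis
      proof (cases "D \<inter> {i..<j} = {} \<or> i \<in> S \<inter> W \<or> j \<in> S \<inter> W")
        case True
        then have "ext_minor n i j \<in> J"
          using contains_gens_ext_minor[OF W g iW jW \<open>i < j\<close>] ext_minor_killed[OF W J JS, of i j] iW jW by auto
        from ideal_poly_ringD(4)[OF J this b(1)] show ?thesis by (simp add: mult.commute)
      next
        case False
        have "\<not> standard n S D m'"
        proof
          assume st: "standard n S D m'"
          have "VX s \<notin> Poly_Mapping.keys m \<and> VY s \<notin> Poly_Mapping.keys m" if "s \<in> S" for s
            using st that False keysW[of s] keysW
            by (auto simp: keys_m standard_def a_def c_def split: if_splits)
          with ns obtain u v where u: "u \<in> xsupp m" and v: "v \<in> ysupp n m" and "u < v" and D: "D \<inter> {u..<v} = {}"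
            by (auto simp: standard_def)
          have "u \<noteq> i \<or> u = 0"
          proof (rule ccontr)
            assume "\<not> ?thesis"
            then have "u = i" by simp
            with \<open>u < v\<close> v have "j \<le> v" using minj ys by auto
            with D \<open>u = i\<close> False show False by (auto simp: set_eq_iff)
          qed
          then have u': "u \<in> xsupp m'"
            using u by (auto simp: xsupp_def keys_m a_def c_def split: if_splits)
          have "v \<noteq> j \<or> v = n + 1"
          proof (rule ccontr)
            assume "\<not> ?thesis"
            then have "v = j" by simp
            with \<open>u < v\<close> u have "u \<le> i" using mini xs by auto
            with D \<open>v = j\<close> False show False by (auto simp: set_eq_iff)
          qed
          then have v': "v \<in> ysupp n m'"
            using v by (auto simp: ysupp_def keys_m a_def c_def split: if_splits)
          from st u' v' \<open>u < v\<close> D show False by (auto simp: standard_def)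
        qed
        then have "b \<in> J" using bJ g by blast
        from ideal_poly_ringD(4)[OF J this hc] show ?thesis .
      qed
    qed
    ultimately show ?thesis by blast
  qed
qed

section \<open>Independence of standard monomials\<close>

lemma ideal_sum_closed:
  assumes "ideal J (poly_ring W :: 'k::field mpoly ring)" "\<And>i. i \<in> A \<Longrightarrow> f i \<in> J"
  shows "(\<Sum>i\<in>A. f i) \<in> J"
  using assms(2) by (induction A rule: infinite_finite_induct)
    (auto intro: ideal_poly_ringD[OF assms(1)])

lemma const_carrier: "Poly_Mapping.single 0 c \<in> carrier (poly_ring W)"
  by (simp add: single_carrier monomials_def)

lemma lookup_const_mult: "Poly_Mapping.lookup (Poly_Mapping.single 0 (c::'k::field) * q) m = c * Poly_Mapping.lookup q m"
  by (simp flip: mult_map_scale_conv_mult add: map.rep_eq when_def)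

lemma keys_const_mult: "Poly_Mapping.keys (Poly_Mapping.single 0 (c::'k::field) * q) \<subseteq> Poly_Mapping.keys q"
  by (auto simp: in_keys_iff lookup_const_mult)

definition standards :: "int set \<Rightarrow> int \<Rightarrow> int set \<Rightarrow> int set \<Rightarrow> (var \<Rightarrow>\<^sub>0 nat) set" where
  "standards W n S D = {m \<in> monomials W. standard n S D m}"

lemma keys_lin_comb:
  fixes s :: "'i \<Rightarrow> ('a::monoid_add \<Rightarrow>\<^sub>0 'k::field)"
  assumes "\<And>i. i \<in> A \<Longrightarrow> Poly_Mapping.keys (s i) \<subseteq> T"
  shows "Poly_Mapping.keys (\<Sum>i\<in>A. Poly_Mapping.single 0 (c i) * s i) \<subseteq> T"
proof
  fix m assume "m \<in> Poly_Mapping.keys (\<Sum>i\<in>A. Poly_Mapping.single 0 (c i) * s i)"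
  then have "(\<Sum>i\<in>A. c i * Poly_Mapping.lookup (s i) m) \<noteq> 0"
    by (simp add: in_keys_iff lookup_sum lookup_const_mult)
  then obtain i where "i \<in> A" "c i * Poly_Mapping.lookup (s i) m \<noteq> 0"
    by (meson sum.not_neutral_contains_not_neutral)
  then show "m \<in> T" using assms[of i] by (auto simp: in_keys_iff)
qed

text \<open>A nonstandard monomial is congruent to $m - b_m$, whose monomials have smaller weight.\<close>

lemma monomial_reduction:
  fixes J :: "'k::field mpoly set"
  assumes W: "W \<subseteq> {1..n}" and n: "0 \<le> n" and g: "contains_gens W n S D J" and m: "m \<in> monomials W"
  shows "\<exists>s. Poly_Mapping.keys s \<subseteq> standards W n S D \<and> Poly_Mapping.single m 1 - s \<in> J \<and>
    (if standard n S D m then s = Poly_Mapping.single m 1 else s \<in> low_weight n (weight n m))"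
  using m
proof (induction "weight n m" arbitrary: m rule: less_induct)
  case less
  have J: "ideal J (poly_ring W)" using g by (simp add: contains_gens_def)
  show ?case
  proof (cases "standard n S D m")
    case True
    then show ?thesis using less.prems ideal_poly_ringD(2)[OF J]
      by (intro exI[of _ "Poly_Mapping.single m 1"]) (simp add: standards_def)
  next
    case False
    from straightened_monomial[OF W n less.prems] False g
    obtain b where b: "b \<in> carrier (poly_ring W :: 'k mpoly ring)"
      "b - Poly_Mapping.single m 1 \<in> low_weight n (weight n m)" "b \<in> J" by blast
    define r where "r = b - Poly_Mapping.single m 1"
    have r: "r \<in> low_weight n (weight n m)" "Poly_Mapping.keys r \<subseteq> monomials W"
      using b carrier_poly_ring_closed(3)[OF b(1) single_carrier[OF less.prems, of 1]]
      by (simp_all add: r_def carrier_iff)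
    have "\<exists>s. Poly_Mapping.keys s \<subseteq> standards W n S D \<and> Poly_Mapping.single m' 1 - s \<in> J \<and>
        s \<in> low_weight n (weight n m)" if "m' \<in> Poly_Mapping.keys r" for m'
    proof -
      have w: "weight n m' < weight n m" "m' \<in> monomials W" using r that by (auto simp: low_weight_def)
      from less.hyps[OF this] obtain s where s: "Poly_Mapping.keys s \<subseteq> standards W n S D"
        "Poly_Mapping.single m' 1 - s \<in> J"
        "if standard n S D m' then s = Poly_Mapping.single m' 1 else s \<in> low_weight n (weight n m')" by blast
      have "s \<in> low_weight n (weight n m)"
        using s(3) w low_weight_mono[of s n "weight n m'" "weight n m"]
        by (auto split: if_splits intro: low_weight_single)
      with s show ?thesis by blast
    qed
    then obtain s where s: "\<And>m'. m' \<in> Poly_Mapping.keys r \<Longrightarrow> Poly_Mapping.keys (s m') \<subseteq> standards W n S D"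
      "\<And>m'. m' \<in> Poly_Mapping.keys r \<Longrightarrow> Poly_Mapping.single m' 1 - s m' \<in> J"
      "\<And>m'. m' \<in> Poly_Mapping.keys r \<Longrightarrow> s m' \<in> low_weight n (weight n m)" by metis
    define t where "t = (\<Sum>m'\<in>Poly_Mapping.keys r. Poly_Mapping.single 0 (Poly_Mapping.lookup r m') * s m')"
    have "r - t = (\<Sum>m'\<in>Poly_Mapping.keys r. Poly_Mapping.single 0 (Poly_Mapping.lookup r m') *
        (Poly_Mapping.single m' 1 - s m'))"
      using sum_single_lookup[of r]
      by (simp add: t_def right_diff_distrib sum_subtractf mult_single)
    also have "\<dots> \<in> J"
      by (intro ideal_sum_closed[OF J] ideal_poly_ringD(4)[OF J] s const_carrier)
    finally have "b - (r - t) \<in> J" using b(3) ideal_poly_ringD(5)[OF J] by blast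
    then have "Poly_Mapping.single m 1 - (- t) \<in> J" by (simp add: r_def)
    moreover have "Poly_Mapping.keys (- t) \<subseteq> standards W n S D"
      unfolding t_def using s(1) keys_lin_comb[of "Poly_Mapping.keys r" s] by simp
    moreover have "- t \<in> low_weight n (weight n m)"
      unfolding t_def
    proof (intro low_weight_uminus low_weight_sum)
      fix m' assume "m' \<in> Poly_Mapping.keys r"
      from s(3)[OF this] show "Poly_Mapping.single 0 (Poly_Mapping.lookup r m') * s m' \<in> low_weight n (weight n m)"
        using keys_const_mult[of "Poly_Mapping.lookup r m'" "s m'"] by (auto simp: low_weight_def)
    qed
    ultimately show ?thesis using False by (intro exI[of _ "- t"]) simp
  qed
qed

text \<open>A standard monomial of top weight keeps its coefficient, since reducing the nonstandard ones
  only produces monomials of smaller weight. This is what identifies leading monomials in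
  \<open>top_weight_nonstandard\<close>.\<close>

lemma reduction:
  fixes J :: "'k::field mpoly set"
  assumes W: "W \<subseteq> {1..n}" and n: "0 \<le> n" and g: "contains_gens W n S D J" and p: "p \<in> carrier (poly_ring W)"
  obtains s where "Poly_Mapping.keys s \<subseteq> standards W n S D" "p - s \<in> J"
    "\<And>m. m \<in> Poly_Mapping.keys p \<Longrightarrow> standard n S D m \<Longrightarrow>
       (\<forall>m'\<in>Poly_Mapping.keys p. weight n m' \<le> weight n m) \<Longrightarrow> Poly_Mapping.lookup s m = Poly_Mapping.lookup p m"
proof -
  have J: "ideal J (poly_ring W)" using g by (simp add: contains_gens_def)
  have "\<forall>m\<in>Poly_Mapping.keys p. \<exists>s. Poly_Mapping.keys s \<subseteq> standards W n S D \<and>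
      Poly_Mapping.single m 1 - s \<in> J \<and>
      (if standard n S D m then s = Poly_Mapping.single m 1 else s \<in> low_weight n (weight n m))"
  proof
    fix m assume "m \<in> Poly_Mapping.keys p"
    then have "m \<in> monomials W" using p by (auto simp: carrier_iff)
    from monomial_reduction[OF W n g this]
    show "\<exists>s. Poly_Mapping.keys s \<subseteq> standards W n S D \<and> Poly_Mapping.single m 1 - s \<in> J \<and>
      (if standard n S D m then s = Poly_Mapping.single m 1 else s \<in> low_weight n (weight n m))" .
  qed
  from bchoice[OF this] obtain s where s_all: "\<forall>m\<in>Poly_Mapping.keys p.
      Poly_Mapping.keys (s m) \<subseteq> standards W n S D \<and> Poly_Mapping.single m 1 - s m \<in> J \<and>
      (if standard n S D m then s m = Poly_Mapping.single m 1 else s m \<in> low_weight n (weight n m))" ..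
  have s: "Poly_Mapping.keys (s m) \<subseteq> standards W n S D" "Poly_Mapping.single m 1 - s m \<in> J"
    "if standard n S D m then s m = Poly_Mapping.single m 1 else s m \<in> low_weight n (weight n m)"
    if "m \<in> Poly_Mapping.keys p" for m
    using bspec[OF s_all that] by simp_all
  define t where "t = (\<Sum>m\<in>Poly_Mapping.keys p. Poly_Mapping.single 0 (Poly_Mapping.lookup p m) * s m)"
  show thesis
  proof (rule that[of t])
    show "Poly_Mapping.keys t \<subseteq> standards W n S D"
      unfolding t_def using s(1) by (rule keys_lin_comb)
    have "p - t = (\<Sum>m\<in>Poly_Mapping.keys p. Poly_Mapping.single 0 (Poly_Mapping.lookup p m) *
        (Poly_Mapping.single m 1 - s m))"
      using sum_single_lookup[of p]
      by (simp add: t_def right_diff_distrib sum_subtractf mult_single)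
    also have "\<dots> \<in> J"
      by (intro ideal_sum_closed[OF J] ideal_poly_ringD(4)[OF J] s const_carrier)
    finally show "p - t \<in> J" .
    fix m assume m: "m \<in> Poly_Mapping.keys p" "standard n S D m"
      "\<forall>m'\<in>Poly_Mapping.keys p. weight n m' \<le> weight n m"
    have "Poly_Mapping.lookup (s m') m = (if m' = m then 1 else 0)" if m': "m' \<in> Poly_Mapping.keys p" for m'
    proof (cases "standard n S D m'")
      case True
      then show ?thesis using s(3)[OF m'] by (auto simp: lookup_single when_def)
    next
      case False
      then have "s m' \<in> low_weight n (weight n m')" "m' \<noteq> m" using s(3)[OF m'] m(2) by auto
      moreover have "weight n m' \<le> weight n m" using m(3) m' by blast
      ultimately have "m \<notin> Poly_Mapping.keys (s m')" by (auto simp: low_weight_def)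
      with \<open>m' \<noteq> m\<close> show ?thesis by (simp add: in_keys_iff)
    qed
    then have "Poly_Mapping.lookup t m =
        (\<Sum>m'\<in>Poly_Mapping.keys p. if m' = m then Poly_Mapping.lookup p m else 0)"
      unfolding t_def lookup_sum lookup_const_mult by (intro sum.cong) auto
    then show "Poly_Mapping.lookup t m = Poly_Mapping.lookup p m"
      using m(1) by simp
  qed
qed

lemma standard_alive:
  assumes W: "W \<subseteq> {1..n}" and m: "m \<in> standards W n S D"
  shows "Poly_Mapping.keys m \<inter> killed_vars n S D = {}"
proof -
  have W': "\<And>i. VX i \<in> Poly_Mapping.keys m \<Longrightarrow> i \<in> {1..n}" "\<And>i. VY i \<in> Poly_Mapping.keys m \<Longrightarrow> i \<in> {1..n}"
    using m W by (force simp: standards_def monomials_def)+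
  have "VX i \<notin> Poly_Mapping.keys m" if "i \<in> S \<or> D \<inter> {i..n} = {}" for i
  proof
    assume *: "VX i \<in> Poly_Mapping.keys m"
    have "{i..<n + 1} = {i..n}" by auto
    then have "i \<in> S \<or> D \<inter> {i..<n + 1} = {}" using that by simp
    moreover have "i \<in> xsupp m" "n + 1 \<in> ysupp n m" "i < n + 1"
      using * W'(1)[OF *] by (auto simp: xsupp_def ysupp_def)
    ultimately show False using * m by (auto simp: standards_def standard_def)
  qed
  moreover have "VY i \<notin> Poly_Mapping.keys m" if "i \<in> S \<or> D \<inter> {0..<i} = {}" for i
  proof
    assume *: "VY i \<in> Poly_Mapping.keys m"
    have "0 < i" using W'(2)[OF *] by simp
    moreover have "0 \<in> xsupp m" "i \<in> ysupp n m"
      using * by (auto simp: xsupp_def ysupp_def)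
    ultimately show False using * that m by (auto simp: standards_def standard_def)
  qed
  ultimately show ?thesis by (auto simp: killed_vars_def)
qed

lemma image_expo_lookup_pos:
  assumes "i \<in> {1..n}"
  shows "Poly_Mapping.lookup (image_expo n D m) i = Poly_Mapping.lookup m (VX i) + Poly_Mapping.lookup m (VY i)"
proof -
  have "- int (block D j) \<noteq> i" for j using assms by simp
  then show ?thesis using assms
    by (simp add: image_expo_def lookup_sum lookup_add lookup_single when_def sum.delta cong: if_cong)
qed

lemma image_expo_lookup_neg:
  "Poly_Mapping.lookup (image_expo n D m) (- int c) = (\<Sum>i\<in>{i\<in>{1..n}. block D i = c}. Poly_Mapping.lookup m (VY i))"
proof -
  have "Poly_Mapping.lookup (image_expo n D m) (- int c) =
    (\<Sum>i\<in>{1..n}. if block D i = c then Poly_Mapping.lookup m (VY i) else 0)"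
    by (auto simp: image_expo_def lookup_sum lookup_add lookup_single when_def intro!: sum.cong)
  also have "\<dots> = (\<Sum>i\<in>{i\<in>{1..n}. block D i = c}. Poly_Mapping.lookup m (VY i))"
    by (rule sum.inter_filter[symmetric]) simp
  finally show ?thesis .
qed

lemma block_eq_iff:
  assumes "0 \<le> i" "i \<le> j"
  shows "block D i = block D j \<longleftrightarrow> D \<inter> {i..<j} = {}"
proof -
  have "D \<inter> {0..<j} = (D \<inter> {0..<i}) \<union> (D \<inter> {i..<j})" using assms by auto
  then have "block D j = block D i + card (D \<inter> {i..<j})"
    by (simp add: block_def) (subst card_Un_disjoint, auto)
  then show ?thesis by auto
qed

text \<open>In a standard monomial, the variables $y_j$ of one block come before the variables $x_i$ of
  that block, so the total $y$-degree of the block, which is visible in the image, is used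
  up from the left. If two standard monomials with the same image differ first in the degree
  of $y_i$, then the one with fewer $y_i$ makes up for it by some $y_j$ further to the right
  in the block, while it is also divisible by $x_i$.\<close>

lemma image_expo_standard_aux:
  assumes W: "W \<subseteq> {1..n}" and m: "m \<in> standards W n S D" and m': "m' \<in> standards W n S D"
    and e: "image_expo n D m = image_expo n D m'" and i: "i \<in> {1..n}"
    and less: "Poly_Mapping.lookup m (VY i) < Poly_Mapping.lookup m' (VY i)"
    and before: "\<And>j. j \<in> {1..<i} \<Longrightarrow> Poly_Mapping.lookup m (VY j) = Poly_Mapping.lookup m' (VY j)"
  shows False
proof -
  let ?B = "{j\<in>{1..n}. block D j = block D i}"
  have "i \<in> ?B" using i by simp
  have fin: "finite ?B" by (rule finite_subset[of _ "{1..n}"]) auto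
  have sum_eq: "(\<Sum>j\<in>?B. Poly_Mapping.lookup m (VY j)) = (\<Sum>j\<in>?B. Poly_Mapping.lookup m' (VY j))"
    using e image_expo_lookup_neg[of n D _ "block D i"] by metis
  have less_sum: "(\<Sum>j\<in>?B. Poly_Mapping.lookup m (VY j)) < (\<Sum>j\<in>?B. Poly_Mapping.lookup m' (VY j))"
    if "\<forall>j\<in>?B. Poly_Mapping.lookup m (VY j) \<le> Poly_Mapping.lookup m' (VY j)"
    using that less \<open>i \<in> ?B\<close> by (intro sum_strict_mono_ex1[OF fin]) auto
  have "\<not> (\<forall>j\<in>?B. Poly_Mapping.lookup m (VY j) \<le> Poly_Mapping.lookup m' (VY j))"
    using less_sum sum_eq by linarith
  then obtain j where "j \<in> ?B" "\<not> Poly_Mapping.lookup m (VY j) \<le> Poly_Mapping.lookup m' (VY j)"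
    by blast
  then have j: "j \<in> {1..n}" "block D j = block D i" "Poly_Mapping.lookup m (VY j) > Poly_Mapping.lookup m' (VY j)"
    by simp_all
  have "i < j"
  proof (rule ccontr)
    assume "\<not> i < j"
    then have "j = i \<or> j \<in> {1..<i}" using j(1) by auto
    then show False using before[of j] j(3) less by auto
  qed
  then have "D \<inter> {i..<j} = {}" using block_eq_iff[of i j D] i j(2) by simp
  moreover have "Poly_Mapping.lookup m (VX i) > 0"
    using less image_expo_lookup_pos[OF i, of D m] image_expo_lookup_pos[OF i, of D m'] e by simp
  moreover have "Poly_Mapping.lookup m (VY j) > 0" using j by simp
  ultimately show False using m \<open>i < j\<close>
    by (auto simp: standards_def standard_def xsupp_def ysupp_def in_keys_iff)
qed

lemma image_expo_inj_on_standards: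
  assumes W: "W \<subseteq> {1..n}"
  shows "inj_on (image_expo n D) (standards W n S D)"
proof (rule inj_onI)
  fix m m' assume m: "m \<in> standards W n S D" and m': "m' \<in> standards W n S D"
    and e: "image_expo n D m = image_expo n D m'"
  have y: "Poly_Mapping.lookup m (VY i) = Poly_Mapping.lookup m' (VY i)" if "i \<in> {1..n}" for i
    using that
  proof (induction "nat i" arbitrary: i rule: less_induct)
    case less
    have "Poly_Mapping.lookup m (VY j) = Poly_Mapping.lookup m' (VY j)" if "j \<in> {1..<i}" for j
      using less.hyps[of j] less.prems that by auto
    then show ?case
      using image_expo_standard_aux[OF W m m' e less.prems] image_expo_standard_aux[OF W m' m e[symmetric] less.prems]
      by (metis not_less_iff_gr_or_eq)
  qed
  have x: "Poly_Mapping.lookup m (VX i) = Poly_Mapping.lookup m' (VX i)" if "i \<in> {1..n}" for i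
    using y[OF that] image_expo_lookup_pos[OF that, of D m] image_expo_lookup_pos[OF that, of D m'] e by simp
  have out: "Poly_Mapping.lookup q v = 0" if "q \<in> standards W n S D" "var_index v \<notin> {1..n}" for q v
  proof -
    have "var_index ` Poly_Mapping.keys q \<subseteq> {1..n}" using that(1) W by (auto simp: standards_def monomials_def)
    then have "v \<notin> Poly_Mapping.keys q" using that(2) by blast
    then show ?thesis by (simp add: in_keys_iff)
  qed
  show "m = m'"
  proof (rule poly_mapping_eqI)
    fix v show "Poly_Mapping.lookup m v = Poly_Mapping.lookup m' v"
      using x y out[OF m, of v] out[OF m', of v] by (cases v; cases "var_index v \<in> {1..n}") auto
  qed
qed

text \<open>Distinct standard monomials have distinct monomials as images.\<close>

lemma param_inj_standard:
  fixes s :: "'k::field mpoly"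
  assumes W: "W \<subseteq> {1..n}" and s: "Poly_Mapping.keys s \<subseteq> standards W n S D" and z: "param n S D s = 0"
  shows "s = 0"
proof (rule poly_mapping_eqI)
  fix m show "Poly_Mapping.lookup s m = Poly_Mapping.lookup 0 m"
  proof (cases "m \<in> Poly_Mapping.keys s")
    case True
    have "param n S D s = (\<Sum>m'\<in>Poly_Mapping.keys s. Poly_Mapping.single (image_expo n D m') (Poly_Mapping.lookup s m'))"
      unfolding linear_extension_def
    proof (rule sum.cong)
      fix m' assume "m' \<in> Poly_Mapping.keys s"
      then have "Poly_Mapping.keys m' \<inter> killed_vars n S D = {}" using standard_alive[OF W] s by blast
      then show "Poly_Mapping.single 0 (Poly_Mapping.lookup s m') * mono_map n S D m' =
          Poly_Mapping.single (image_expo n D m') (Poly_Mapping.lookup s m')"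
        by (simp add: mono_map_def mult_single)
    qed simp
    then have "Poly_Mapping.lookup (param n S D s) (image_expo n D m) =
        (\<Sum>m'\<in>Poly_Mapping.keys s. Poly_Mapping.lookup s m' when image_expo n D m' = image_expo n D m)"
      by (simp add: lookup_sum lookup_single)
    also have "\<dots> = (\<Sum>m'\<in>Poly_Mapping.keys s. Poly_Mapping.lookup s m' when m' = m)"
      using inj_onD[OF image_expo_inj_on_standards[OF W, of D S]] s True
      by (intro sum.cong refl when_cong) blast+
    also have "\<dots> = Poly_Mapping.lookup s m" using True by (simp add: when_def)
    finally show ?thesis using z by simp
  qed (simp add: in_keys_iff)
qed

section \<open>Generators and leading monomials of block primes\<close>

lemma single_one_nonzero [simp]: "Poly_Mapping.single k (1::'k::field) \<noteq> 0"
  by (metis lookup_single_eq lookup_zero zero_neq_one)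

lemma param_single: "param n S D (Poly_Mapping.single m 1) = mono_map n S D m"
  by (simp add: linear_extension_single)

lemma image_expo_single_VX:
  assumes "i \<in> {1..n}"
  shows "image_expo n D (Poly_Mapping.single (VX i) 1) = Poly_Mapping.single i 1"
proof -
  have "image_expo n D (Poly_Mapping.single (VX i) 1) = (\<Sum>j\<in>{1..n}. if j = i then Poly_Mapping.single i 1 else 0)"
    unfolding image_expo_def by (intro sum.cong) (auto simp: lookup_single when_def)
  then show ?thesis using assms by simp
qed

lemma image_expo_single_VY:
  assumes "i \<in> {1..n}"
  shows "image_expo n D (Poly_Mapping.single (VY i) 1) =
    Poly_Mapping.single i 1 + Poly_Mapping.single (- int (block D i)) 1"
proof -
  have "image_expo n D (Poly_Mapping.single (VY i) 1) = (\<Sum>j\<in>{1..n}. if j = i then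
      Poly_Mapping.single i 1 + Poly_Mapping.single (- int (block D i)) 1 else 0)"
    unfolding image_expo_def by (intro sum.cong) (auto simp: lookup_single when_def)
  then show ?thesis using assms by simp
qed

lemma xx_mult_yy:
  "xx i * yy j = Poly_Mapping.single (Poly_Mapping.single (VX i) 1 + Poly_Mapping.single (VY j) 1) 1"
  by (simp add: xx_def yy_def mult_single)

lemma param_xx_yy:
  assumes "i \<in> {1..n}" "j \<in> {1..n}"
  shows "param n S D (xx i * yy j :: 'k::field mpoly) =
    (if VX i \<in> killed_vars n S D \<or> VY j \<in> killed_vars n S D then 0
     else Poly_Mapping.single (Poly_Mapping.single i 1 + Poly_Mapping.single j 1 +
       Poly_Mapping.single (- int (block D j)) 1) 1)"
  unfolding xx_mult_yy param_single mono_map_def using assms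
  by (auto simp: keys_add_mono image_expo_add image_expo_single_VX image_expo_single_VY add.assoc simp del: One_nat_def)

lemma xx_block_prime: "i \<in> W \<Longrightarrow> xx i \<in> block_prime W n S D \<longleftrightarrow> VX i \<in> killed_vars n S D"
  by (auto simp: block_prime_def xx_yy_in_poly_ring) (simp_all add: xx_def param_single mono_map_def split: if_splits)

lemma yy_block_prime: "i \<in> W \<Longrightarrow> yy i \<in> block_prime W n S D \<longleftrightarrow> VY i \<in> killed_vars n S D"
  by (auto simp: block_prime_def xx_yy_in_poly_ring) (simp_all add: yy_def param_single mono_map_def split: if_splits)

text \<open>The two terms of $F_{ij}$ have the same image exactly if $i$ and $j$ carry the same block
  label. If one of the indices is $0$ or $n + 1$, then $F_{ij}$ is a variable or a constant.\<close>

lemma ext_minor_block_prime_iff: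
  assumes W: "W \<subseteq> {1..n}" and D: "D \<inter> {0..n} \<noteq> {}" and n: "0 \<le> n"
    and i: "i \<in> insert 0 (W - S)" and j: "j \<in> insert (n + 1) (W - S)" and "i < j"
  shows "(ext_minor n i j :: 'k::field mpoly) \<in> block_prime W n S D \<longleftrightarrow> D \<inter> {i..<j} = {}"
proof -
  have up: "{u..<n + 1} = {u..n}" for u by auto
  consider "i = 0" "j = n + 1" | "i = 0" "j \<in> W - S" | "i \<in> W - S" "j = n + 1" | "i \<in> W - S" "j \<in> W - S"
    using i j by blast
  then show ?thesis
  proof cases
    case 1
    then show ?thesis using D n up[of 0] by (simp add: ext_minor_def ext_x_def ext_y_def block_prime_def)
  next
    case 2
    then have "ext_minor n i j = (yy j :: 'k mpoly)" using W by (force simp: ext_minor_def ext_x_def ext_y_def)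
    then show ?thesis using 2 yy_block_prime[of j W n S D] by (auto simp: killed_vars_def)
  next
    case 3
    then have "ext_minor n i j = (xx i :: 'k mpoly)" using W n by (force simp: ext_minor_def ext_x_def ext_y_def)
    then show ?thesis using 3 up[of i] xx_block_prime[of i W n S D] by (auto simp: killed_vars_def)
  next
    case 4
    then have ij: "i \<in> {1..n}" "j \<in> {1..n}" using W by auto
    have param: "param n S D (minor i j :: 'k mpoly) = param n S D (xx i * yy j) - param n S D (xx j * yy i)"
      by (simp add: minor_def linear_extension_minus)
    have mem: "(minor i j :: 'k mpoly) \<in> block_prime W n S D \<longleftrightarrow> param n S D (minor i j :: 'k mpoly) = 0"
      using ext_minor_carrier[of i n W j, where 'a = 'k] 4 by (simp add: block_prime_def ext_minor_inner[OF W, of i j])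
    have "param n S D (minor i j :: 'k mpoly) = 0 \<longleftrightarrow> D \<inter> {i..<j} = {}"
    proof
      assume "D \<inter> {i..<j} = {}"
      moreover have "{i..n} = {i..<j} \<union> {j..n}" "{0..<j} = {0..<i} \<union> {i..<j}" using ij \<open>i < j\<close> by auto
      ultimately have "D \<inter> {i..n} = D \<inter> {j..n}" "D \<inter> {0..<j} = D \<inter> {0..<i}" "block D i = block D j"
        using block_eq_iff[of i j D] ij \<open>i < j\<close> by auto
      then show "param n S D (minor i j :: 'k mpoly) = 0"
        unfolding param using ij 4 by (simp add: param_xx_yy killed_vars_def add.commute)
    next
      assume z: "param n S D (minor i j :: 'k mpoly) = 0"
      show "D \<inter> {i..<j} = {}"
      proof (rule ccontr)
        assume ne: "D \<inter> {i..<j} \<noteq> {}"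
        then have "D \<inter> {i..n} \<noteq> {}" "D \<inter> {0..<j} \<noteq> {}" using ij by force+
        then have "VX i \<notin> killed_vars n S D" "VY j \<notin> killed_vars n S D" using 4 by (auto simp: killed_vars_def)
        define e where "e c = Poly_Mapping.single i 1 + Poly_Mapping.single j 1 +
          Poly_Mapping.single (- int c) (1::nat)" for c
        have "param n S D (xx i * yy j :: 'k mpoly) = Poly_Mapping.single (e (block D j)) 1"
          using ij \<open>VX i \<notin> killed_vars n S D\<close> \<open>VY j \<notin> killed_vars n S D\<close> by (simp add: param_xx_yy e_def)
        moreover have "param n S D (xx j * yy i :: 'k mpoly) \<in> {0, Poly_Mapping.single (e (block D i)) 1}"
          using ij by (simp add: param_xx_yy e_def ac_simps)
        ultimately have "(Poly_Mapping.single (e (block D j)) 1 :: _ \<Rightarrow>\<^sub>0 'k) \<in> {0, Poly_Mapping.single (e (block D i)) 1}"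
          using z unfolding param by simp
        then have "(Poly_Mapping.single (e (block D j)) 1 :: _ \<Rightarrow>\<^sub>0 'k) = Poly_Mapping.single (e (block D i)) 1"
          by simp
        then have "e (block D j) = e (block D i)"
          by (metis lookup_single_eq lookup_single_not_eq zero_neq_one)
        then have "Poly_Mapping.single (- int (block D j)) (1::nat) = Poly_Mapping.single (- int (block D i)) 1"
          unfolding e_def by (rule add_left_imp_eq)
        then have "block D i = block D j"
          by (metis lookup_single_eq lookup_single_not_eq zero_neq_one neg_equal_iff_equal of_nat_eq_iff)
        then show False using block_eq_iff[of i j D] ij \<open>i < j\<close> ne by auto
      qed
    qed
    then show ?thesis using mem 4 by (simp add: ext_minor_inner[OF W, of i j])
  qed
qed

lemma contains_gens_block_prime:
  assumes W: "W \<subseteq> {1..n}" and D: "D \<inter> {0..n} \<noteq> {}" and n: "0 \<le> n"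
  shows "contains_gens W n S D (block_prime W n S D)"
  unfolding contains_gens_def
  using ext_minor_block_prime_iff[OF W D n] ideal_block_prime
  by (auto simp: xx_block_prime yy_block_prime) (auto simp: killed_vars_def)

lemma contains_gens_Int:
  assumes "contains_gens W n S D J" "contains_gens W n S D J'"
  shows "contains_gens W n S D (J \<inter> J')"
  using assms ring.i_intersect[OF cring.axioms(1)[OF cring_poly_ring]] by (auto simp: contains_gens_def)

text \<open>$P(S, D)$ is generated by its obvious generators: modulo these, every element reduces to a
  combination of standard monomials, and the parametrisation is injective on such
  combinations. Intersecting with the kernel keeps the reduction inside $P(S, D)$.\<close>

lemma block_prime_least:
  fixes J :: "'k::field mpoly set"
  assumes W: "W \<subseteq> {1..n}" and D: "D \<inter> {0..n} \<noteq> {}" and n: "0 \<le> n" and g: "contains_gens W n S D J"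
  shows "block_prime W n S D \<subseteq> J"
proof
  fix p :: "'k mpoly" assume p: "p \<in> block_prime W n S D"
  then have pc: "p \<in> carrier (poly_ring W)" by (simp add: block_prime_def)
  from reduction[OF W n contains_gens_Int[OF g contains_gens_block_prime[OF W D n]] pc]
  obtain s where s: "Poly_Mapping.keys s \<subseteq> standards W n S D" "p - s \<in> J \<inter> block_prime W n S D" by blast
  then have "param n S D s = 0" using p by (simp add: block_prime_def linear_extension_minus)
  with s show "p \<in> J" using param_inj_standard[OF W s(1)] by simp
qed

text \<open>Reduction keeps the coefficient of a standard monomial of top weight, whereas an element of
  $P(S, D)$ reduces to $0$.\<close>

lemma top_weight_nonstandard:
  assumes W: "W \<subseteq> {1..n}" and D: "D \<inter> {0..n} \<noteq> {}" and n: "0 \<le> n" and p: "p \<in> block_prime W n S D"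
    and m: "m \<in> Poly_Mapping.keys p" "\<forall>m'\<in>Poly_Mapping.keys p. weight n m' \<le> weight n m"
  shows "\<not> standard n S D m"
proof
  assume st: "standard n S D m"
  have pc: "p \<in> carrier (poly_ring W)" using p by (simp add: block_prime_def)
  obtain s where s: "Poly_Mapping.keys s \<subseteq> standards W n S D" "p - s \<in> block_prime W n S D"
    and "\<And>m. m \<in> Poly_Mapping.keys p \<Longrightarrow> standard n S D m \<Longrightarrow>
       (\<forall>m'\<in>Poly_Mapping.keys p. weight n m' \<le> weight n m) \<Longrightarrow> Poly_Mapping.lookup s m = Poly_Mapping.lookup p m"
    by (rule reduction[OF W n contains_gens_block_prime[OF W D n] pc]) blast
  then have s3: "Poly_Mapping.lookup s m = Poly_Mapping.lookup p m" using m st by blast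
  from s have "param n S D s = 0" using p by (simp add: block_prime_def linear_extension_minus)
  then have "s = 0" using param_inj_standard[OF W s(1)] by simp
  with s3 m(1) show False by (simp add: in_keys_iff)
qed

text \<open>Inclusions of block primes are tested on generators, and there only on indices outside
  \<open>T\<close>, because a minor with an index in \<open>T\<close> is in the larger ideal
  anyway.\<close>

lemma block_prime_mono:
  assumes W: "W \<subseteq> {1..n}" and D: "D \<inter> {0..n} \<noteq> {}" and E: "E \<inter> {0..n} \<noteq> {}" and n: "0 \<le> n"
    and S: "S \<inter> W \<subseteq> T"
    and blocks: "\<And>u v. u \<in> insert 0 (W - T) \<Longrightarrow> v \<in> insert (n + 1) (W - T) \<Longrightarrow> u < v \<Longrightarrow>
      D \<inter> {u..<v} = {} \<Longrightarrow> E \<inter> {u..<v} = {}"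
  shows "block_prime W n S D \<subseteq> (block_prime W n T E :: 'k::field mpoly set)"
proof (rule block_prime_least[OF W D n])
  have g: "contains_gens W n T E (block_prime W n T E :: 'k mpoly set)"
    by (rule contains_gens_block_prime[OF W E n])
  then have J: "ideal (block_prime W n T E :: 'k mpoly set) (poly_ring W)"
    and JT: "\<forall>s\<in>T \<inter> W. (xx s :: 'k mpoly) \<in> block_prime W n T E \<and> yy s \<in> (block_prime W n T E :: 'k mpoly set)"
    by (auto simp: contains_gens_def)
  have "(ext_minor n u v :: 'k mpoly) \<in> block_prime W n T E"
    if "u \<in> insert 0 (W - S)" "v \<in> insert (n + 1) (W - S)" "u < v" "D \<inter> {u..<v} = {}" for u v
  proof (cases "u \<in> T \<inter> W \<or> v \<in> T \<inter> W")
    case True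
    then show ?thesis using that by (intro ext_minor_killed[OF W J JT]) auto
  next
    case False
    then show ?thesis using that blocks[of u v] by (intro contains_gens_ext_minor[OF W g]) auto
  qed
  then show "contains_gens W n S D (block_prime W n T E :: 'k mpoly set)"
    using J JT S by (auto simp: contains_gens_def)
qed

section \<open>Sums of intersections of block primes\<close>

definition support :: "(var \<Rightarrow>\<^sub>0 nat) \<Rightarrow> int set" where
  "support m = var_index ` Poly_Mapping.keys m"

lemma support_eq: "support m = {i. VX i \<in> Poly_Mapping.keys m} \<union> {i. VY i \<in> Poly_Mapping.keys m}"
proof (intro equalityI subsetI)
  fix i assume "i \<in> support m"
  then obtain v where "v \<in> Poly_Mapping.keys m" "i = var_index v" by (auto simp: support_def)
  then show "i \<in> {i. VX i \<in> Poly_Mapping.keys m} \<union> {i. VY i \<in> Poly_Mapping.keys m}"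
    by (cases v) auto
next
  fix i assume "i \<in> {i. VX i \<in> Poly_Mapping.keys m} \<union> {i. VY i \<in> Poly_Mapping.keys m}"
  then show "i \<in> support m" unfolding support_def by (auto intro: rev_image_eqI)
qed

text \<open>Let $T$ be the set of all indices absent from $m$. On the remaining indices, together with
  $0$ and $n + 1$, join $u$ and $v$ by an edge if they are in the same block for one of the
  two pairs, and cut at every gap that no edge spans. The resulting prime contains both
  given primes by construction. If $m$ were nonstandard for the new pair, there would be
  such a witness $x_i y_j$ with $i, j$ adjacent in the support of $m$; the edge that spans
  the gap after $i$ also spans $j$, so $m$ would be nonstandard for one of the given pairs.\<close>

lemma common_refinement:
  assumes n: "0 \<le> n" and m: "m \<in> monomials {1..n}"
    and D1: "D1 \<subseteq> {0..n}" "D1 \<noteq> {}" and D2: "D2 \<subseteq> {0..n}" "D2 \<noteq> {}"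
    and st1: "standard n S1 D1 m" and st2: "standard n S2 D2 m"
  obtains T E where "T \<subseteq> {1..n}" "E \<subseteq> {0..n}" "E \<noteq> {}" "standard n T E m"
    "block_prime {1..n} n S1 D1 \<subseteq> (block_prime {1..n} n T E :: 'k::field mpoly set)"
    "block_prime {1..n} n S2 D2 \<subseteq> (block_prime {1..n} n T E :: 'k::field mpoly set)"
proof -
  define T where "T = {1..n} - support m"
  define edge where "edge u v \<longleftrightarrow> u \<in> insert 0 (support m) \<and> v \<in> insert (n + 1) (support m) \<and> u < v \<and>
    (D1 \<inter> {u..<v} = {} \<or> D2 \<inter> {u..<v} = {})" for u v
  define E where "E = {g \<in> {0..n}. \<not> (\<exists>u v. edge u v \<and> u \<le> g \<and> g < v)}"
  have supp: "support m \<subseteq> {1..n}" using m by (auto simp: monomials_def support_def)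
  have xy: "xsupp m \<subseteq> insert 0 (support m)" "ysupp n m \<subseteq> insert (n + 1) (support m)"
    "support m \<subseteq> xsupp m \<union> ysupp n m"
    by (auto simp: support_eq xsupp_def ysupp_def)
  have stE: "E \<inter> {i..<j} \<noteq> {}" if ij: "i \<in> xsupp m" "j \<in> ysupp n m" "i < j" for i j
  proof
    assume empty: "E \<inter> {i..<j} = {}"
    from adjacent_pair[OF ij] obtain i' j' where i': "i' \<in> xsupp m" and j': "j' \<in> ysupp n m"
      and "i' < j'" "i \<le> i'" "j' \<le> j"
      and mini: "\<And>u. u \<in> xsupp m \<Longrightarrow> i \<le> u \<Longrightarrow> u < j' \<Longrightarrow> u \<le> i'"
      and minj: "\<And>v. v \<in> ysupp n m \<Longrightarrow> v \<le> j \<Longrightarrow> i' < v \<Longrightarrow> j' \<le> v" by metis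
    have range: "0 \<le> i'" "j' \<le> n + 1" using i' j' xy supp by auto
    then have "i' \<in> {0..n}" "i' \<notin> E" using \<open>i' < j'\<close> \<open>i \<le> i'\<close> \<open>j' \<le> j\<close> empty by auto
    then obtain u v where e: "edge u v" "u \<le> i'" "i' < v" by (auto simp: E_def)
    \<comment> \<open>The end of the edge is in the support or equal to \<open>n + 1\<close>, and the pair is adjacent in the support.\<close>
    have "j' \<le> v"
    proof (rule ccontr)
      assume "\<not> j' \<le> v"
      then have "v \<in> support m" "v < j'" using e range by (auto simp: edge_def)
      then show False using xy(3) mini[of v] minj[of v] e(3) \<open>i \<le> i'\<close> \<open>j' \<le> j\<close> by force
    qed
    then have sub: "{i'..<j'} \<subseteq> {u..<v}" using e by auto
    have "D1 \<inter> {u..<v} = {} \<or> D2 \<inter> {u..<v} = {}" using e(1) by (simp add: edge_def)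
    then have "D1 \<inter> {i'..<j'} = {} \<or> D2 \<inter> {i'..<j'} = {}" using sub by blast
    then show False using st1 st2 i' j' \<open>i' < j'\<close> by (auto simp: standard_def)
  qed
  have E: "E \<subseteq> {0..n}" by (auto simp: E_def)
  moreover have "E \<noteq> {}" using stE[of 0 "n + 1"] n by (auto simp: xsupp_def ysupp_def)
  ultimately have E0: "E \<inter> {0..n} \<noteq> {}" by auto
  have st: "standard n T E m" using stE by (auto simp: standard_def T_def support_eq)
  have comp: "{1..n} - T = support m" using supp by (auto simp: T_def)
  have edgeE: "E \<inter> {u..<v} = {}" if "edge u v" for u v using that by (auto simp: E_def)
  have "block_prime {1..n} n S D \<subseteq> (block_prime {1..n} n T E :: 'k mpoly set)"
    if "standard n S D m" "D \<subseteq> {0..n}" "D \<noteq> {}" "D = D1 \<or> D = D2" for S D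
  proof (rule block_prime_mono[OF order_refl _ E0 n])
    show "D \<inter> {0..n} \<noteq> {}" using that by auto
    show "S \<inter> {1..n} \<subseteq> T" using that(1) by (auto simp: T_def standard_def support_eq)
    show "E \<inter> {u..<v} = {}" if "u \<in> insert 0 ({1..n} - T)" "v \<in> insert (n + 1) ({1..n} - T)" "u < v"
      "D \<inter> {u..<v} = {}" for u v
      using that \<open>D = D1 \<or> D = D2\<close> by (intro edgeE) (auto simp: edge_def comp)
  qed
  from this[OF st1 D1] this[OF st2 D2] show thesis
    using \<open>E \<noteq> {}\<close> E st that[of T E] by (auto simp: T_def)
qed

definition cut_data :: "int \<Rightarrow> (int set \<times> int set) set" where
  "cut_data n = {(S, D). S \<subseteq> {1..n} \<and> D \<subseteq> {0..n} \<and> D \<noteq> {}}"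

definition prime_of :: "int \<Rightarrow> int set \<times> int set \<Rightarrow> 'k::field mpoly set" where
  "prime_of n = (\<lambda>(S, D). block_prime {1..n} n S D)"

text \<open>For the empty family this is the whole ring, which occurs as a colon ideal.\<close>

definition prime_inter :: "int \<Rightarrow> (int set \<times> int set) set \<Rightarrow> 'k::field mpoly set" where
  "prime_inter n G = {p \<in> carrier (poly_ring {1..n}). \<forall>x\<in>G. p \<in> prime_of n x}"

lemma finite_cut_data: "finite (cut_data n)"
  by (rule finite_subset[of _ "Pow {1..n} \<times> Pow {0..n}"]) (auto simp: cut_data_def)

lemma ideal_prime_of: "ideal (prime_of n x) (poly_ring {1..n})"
  by (cases x) (simp add: prime_of_def ideal_block_prime)

lemma primeideal_prime_of: "primeideal (prime_of n x) (poly_ring {1..n})"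
  by (cases x) (simp add: prime_of_def primeideal_block_prime)

lemma ideal_prime_inter: "ideal (prime_inter n G) (poly_ring {1..n})"
  by (rule ideal_poly_ringI)
    (auto simp: prime_inter_def carrier_poly_ring_closed intro: ideal_poly_ringD[OF ideal_prime_of])

definition ideal_sum :: "'k::field mpoly set \<Rightarrow> 'k mpoly set \<Rightarrow> 'k mpoly set" where
  "ideal_sum I J = {p + q | p q. p \<in> I \<and> q \<in> J}"

lemma set_add_poly_ring: "I <+>\<^bsub>poly_ring W\<^esub> J = ideal_sum I J"
  by (auto simp: set_add_def' ideal_sum_def)

lemma ideal_ideal_sum: "ideal I (poly_ring W) \<Longrightarrow> ideal J (poly_ring W) \<Longrightarrow> ideal (ideal_sum I J) (poly_ring W)"
  using ring.add_ideals[OF cring.axioms(1)[OF cring_poly_ring]] by (metis set_add_poly_ring)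

lemma ideal_sum_upper:
  assumes "ideal I (poly_ring W)" "ideal J (poly_ring W)"
  shows "I \<subseteq> ideal_sum I J" "J \<subseteq> ideal_sum I J"
proof -
  have "0 \<in> I" "0 \<in> J" using assms ideal_poly_ringD(2) by auto
  then show "I \<subseteq> ideal_sum I J" "J \<subseteq> ideal_sum I J"
    unfolding ideal_sum_def by (auto, metis add.right_neutral, metis add.left_neutral)
qed

lemma ideal_sum_least:
  "ideal K (poly_ring W) \<Longrightarrow> I \<subseteq> K \<Longrightarrow> J \<subseteq> K \<Longrightarrow> ideal_sum I J \<subseteq> K"
  by (auto simp: ideal_sum_def intro!: ideal_poly_ringD(3))

text \<open>Only the inclusion of the intersection over \<open>H\<close> in the sum is nontrivial. Let
  $p$ be in that intersection and let $m$ be a monomial of top weight in $p$. If $b_m$ were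
  neither in $I$ nor in $J$, then $m$ would be standard for some member of each family,
  hence for a common refinement, which belongs to \<open>H\<close>; but leading monomials of
  elements of that prime are nonstandard. So $b_m \in I \cup J$, and subtracting multiples
  of these polynomials lowers the weight of $p$.\<close>

lemma sum_prime_inter:
  fixes n :: int
  assumes n: "0 \<le> n" and G: "G \<subseteq> cut_data n" and G': "G' \<subseteq> cut_data n"
  defines "I \<equiv> (prime_inter n G :: 'k::field mpoly set)" and "J \<equiv> (prime_inter n G' :: 'k::field mpoly set)"
  defines "H \<equiv> {x \<in> cut_data n. I \<subseteq> prime_of n x \<and> J \<subseteq> prime_of n x}"
  shows "ideal_sum I J = prime_inter n H"
proof
  have IJ: "ideal I (poly_ring {1..n})" "ideal J (poly_ring {1..n})"
    by (simp_all add: I_def J_def ideal_prime_inter)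
  show sub: "ideal_sum I J \<subseteq> prime_inter n H"
    by (rule ideal_sum_least[OF ideal_prime_inter]) (auto simp: prime_inter_def H_def I_def J_def)
  have Z: "ideal (ideal_sum I J) (poly_ring {1..n})" by (rule ideal_ideal_sum[OF IJ])
  have lead: "\<exists>b \<in> ideal_sum I J. b - Poly_Mapping.single m 1 \<in> low_weight n (weight n m)"
    if p: "p \<in> prime_inter n H" and m: "m \<in> Poly_Mapping.keys p"
      and top: "\<forall>m'\<in>Poly_Mapping.keys p. weight n m' \<le> weight n m" for p m
  proof -
    have mW: "m \<in> monomials {1..n}" using p m by (auto simp: prime_inter_def carrier_iff)
    from straightened_monomial[OF order_refl n mW] obtain b
      where b: "b \<in> carrier (poly_ring {1..n} :: 'k mpoly ring)" "b - Poly_Mapping.single m 1 \<in> low_weight n (weight n m)"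
      and bJ: "\<And>S D J. contains_gens {1..n} n S D J \<Longrightarrow> \<not> standard n S D m \<Longrightarrow> b \<in> J" by blast
    have in_prime: "b \<in> prime_of n (S, D)" if "(S, D) \<in> cut_data n" "\<not> standard n S D m" for S D
    proof -
      have "D \<inter> {0..n} \<noteq> {}" using that by (auto simp: cut_data_def)
      from bJ[OF contains_gens_block_prime[OF order_refl this n] that(2)] show ?thesis by (simp add: prime_of_def)
    qed
    have "b \<in> I \<or> b \<in> J"
    proof (rule ccontr)
      assume "\<not> ?thesis"
      then obtain S1 D1 S2 D2 where "(S1, D1) \<in> G" "(S2, D2) \<in> G'"
        "b \<notin> prime_of n (S1, D1)" "b \<notin> prime_of n (S2, D2)"
        using b(1) by (force simp: I_def J_def prime_inter_def)
      moreover from this have "(S1, D1) \<in> cut_data n" "(S2, D2) \<in> cut_data n" using G G' by auto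
      ultimately have 1: "standard n S1 D1 m" "D1 \<subseteq> {0..n}" "D1 \<noteq> {}" "(S1, D1) \<in> G"
        and 2: "standard n S2 D2 m" "D2 \<subseteq> {0..n}" "D2 \<noteq> {}" "(S2, D2) \<in> G'"
        using in_prime by (blast, auto simp: cut_data_def)
      obtain T E where TE: "T \<subseteq> {1..n}" "E \<subseteq> {0..n}" "E \<noteq> {}" "standard n T E m"
        "block_prime {1..n} n S1 D1 \<subseteq> (block_prime {1..n} n T E :: 'k mpoly set)"
        "block_prime {1..n} n S2 D2 \<subseteq> (block_prime {1..n} n T E :: 'k mpoly set)"
        by (rule common_refinement[OF n mW 1(2,3) 2(2,3) 1(1) 2(1)])
      have "(T, E) \<in> H"
        using TE 1(4) 2(4) by (auto simp: H_def cut_data_def I_def J_def prime_inter_def prime_of_def)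
      then have "p \<in> block_prime {1..n} n T E" using p by (auto simp: prime_inter_def prime_of_def)
      from top_weight_nonstandard[OF order_refl _ n this m top] TE show False by auto
    qed
    then have "b \<in> ideal_sum I J" using ideal_sum_upper[OF IJ] by blast
    with b(2) show ?thesis by blast
  qed
  have "p \<in> ideal_sum I J" if "p \<in> prime_inter n H" "p \<in> low_weight n k" for p k
    using that
  proof (induction k arbitrary: p)
    case 0
    then have "Poly_Mapping.keys p = {}" by (auto simp: low_weight_def)
    then show ?case using ideal_poly_ringD(2)[OF Z] by simp
  next
    case (Suc k)
    \<comment> \<open>Cancel all terms of top weight at once, each with its own $b_m$.\<close>
    define top where "top = {m \<in> Poly_Mapping.keys p. weight n m = k}"
    have fin: "finite top" "top \<subseteq> Poly_Mapping.keys p" by (auto simp: top_def)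
    have "\<forall>m\<in>top. \<exists>b \<in> ideal_sum I J. b - Poly_Mapping.single m 1 \<in> low_weight n k"
    proof
      fix m assume m: "m \<in> top"
      then have "\<forall>m'\<in>Poly_Mapping.keys p. weight n m' \<le> weight n m"
        using Suc.prems(2) by (auto simp: low_weight_def top_def)
      with lead[OF Suc.prems(1)] m show "\<exists>b \<in> ideal_sum I J. b - Poly_Mapping.single m 1 \<in> low_weight n k"
        by (auto simp: top_def)
    qed
    then obtain b where b: "\<And>m. m \<in> top \<Longrightarrow> b m \<in> ideal_sum I J"
      "\<And>m. m \<in> top \<Longrightarrow> b m - Poly_Mapping.single m 1 \<in> low_weight n k" by metis
    define q where "q = (\<Sum>m\<in>top. Poly_Mapping.single 0 (Poly_Mapping.lookup p m) * b m)"
    have q: "q \<in> ideal_sum I J"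
      unfolding q_def by (intro ideal_sum_closed[OF Z] ideal_poly_ringD(4)[OF Z] b const_carrier)
    have "p = (\<Sum>m\<in>Poly_Mapping.keys p - top. Poly_Mapping.single m (Poly_Mapping.lookup p m)) +
        (\<Sum>m\<in>top. Poly_Mapping.single m (Poly_Mapping.lookup p m))"
      using sum.subset_diff[OF fin(2) finite_keys, of "\<lambda>m. Poly_Mapping.single m (Poly_Mapping.lookup p m)"]
      by (simp only: sum_single_lookup)
    from arg_cong[OF this, of "\<lambda>x. x - q"] have "p - q = (\<Sum>m\<in>Poly_Mapping.keys p - top. Poly_Mapping.single m (Poly_Mapping.lookup p m)) -
        (\<Sum>m\<in>top. Poly_Mapping.single 0 (Poly_Mapping.lookup p m) * (b m - Poly_Mapping.single m 1))"
      by (simp add: q_def right_diff_distrib sum_subtractf mult_single)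
    also have "\<dots> \<in> low_weight n k"
    proof (intro low_weight_minus low_weight_sum)
      fix m assume m: "m \<in> Poly_Mapping.keys p - top"
      then show "Poly_Mapping.single m (Poly_Mapping.lookup p m) \<in> low_weight n k"
        using Suc.prems(2) by (intro low_weight_single) (auto simp: low_weight_def top_def less_Suc_eq)
    next
      fix m assume m: "m \<in> top"
      show "Poly_Mapping.single 0 (Poly_Mapping.lookup p m) * (b m - Poly_Mapping.single m 1) \<in> low_weight n k"
        using b(2)[OF m] keys_const_mult[of "Poly_Mapping.lookup p m" "b m - Poly_Mapping.single m 1"]
        by (auto simp: low_weight_def)
    qed
    finally have "p - q \<in> low_weight n k" .
    moreover have "p - q \<in> prime_inter n H"
      using Suc.prems(1) q sub ideal_poly_ringD(5)[OF ideal_prime_inter] by blast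
    ultimately have "p - q \<in> ideal_sum I J" by (rule Suc.IH[rotated])
    from ideal_poly_ringD(3)[OF Z this q] show ?case by simp
  qed
  moreover have "\<exists>k. p \<in> low_weight n k" for p :: "'k mpoly"
  proof
    show "p \<in> low_weight n (Suc (\<Sum>m\<in>Poly_Mapping.keys p. weight n m))"
      by (auto simp: low_weight_def less_Suc_eq_le intro: member_le_sum)
  qed
  ultimately show "prime_inter n H \<subseteq> ideal_sum I J" by blast
qed

text \<open>For a prime $P$, the ideal $P : J$ is the whole ring if $J \subseteq P$ and is $P$
  otherwise.\<close>

lemma colon_prime_inter:
  fixes n :: int
  assumes J: "ideal J (poly_ring {1..n} :: 'k::field mpoly ring)"
  shows "colon_ideal (poly_ring {1..n}) (prime_inter n G) J = prime_inter n {x \<in> G. \<not> J \<subseteq> prime_of n x}"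
proof -
  have Jc: "b \<in> carrier (poly_ring {1..n})" if "b \<in> J" for b using ideal_poly_ringD(1)[OF J] that by auto
  have "a \<in> prime_of n x" if a: "a \<in> carrier (poly_ring {1..n})" "\<forall>b\<in>J. a * b \<in> prime_inter n G"
    and x: "x \<in> G" "\<not> J \<subseteq> prime_of n x" for a x
  proof -
    obtain b where b: "b \<in> J" "b \<notin> prime_of n x" using x by blast
    then have "a \<otimes>\<^bsub>poly_ring {1..n}\<^esub> b \<in> prime_of n x" using a x by (auto simp: prime_inter_def)
    then show ?thesis using primeideal.I_prime[OF primeideal_prime_of a(1) Jc[OF b(1)]] b by blast
  qed
  moreover have "a * b \<in> prime_of n x" if a: "a \<in> prime_inter n {x \<in> G. \<not> J \<subseteq> prime_of n x}"
    and b: "b \<in> J" and x: "x \<in> G" for a b x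
  proof (cases "J \<subseteq> prime_of n x")
    case True
    then have "b \<in> prime_of n x" using b by blast
    from ideal_poly_ringD(4)[OF ideal_prime_of this, of a] show ?thesis using a by (simp add: prime_inter_def)
  next
    case False
    then have "a \<in> prime_of n x" using a x unfolding prime_inter_def by blast
    from ideal_poly_ringD(4)[OF ideal_prime_of this Jc[OF b]] show ?thesis by (simp add: mult.commute)
  qed
  ultimately show ?thesis
    unfolding colon_ideal_def using Jc
    by (intro equalityI subsetI) (simp_all add: prime_inter_def carrier_poly_ring_closed)
qed

lemma Int_prime_inter: "prime_inter n G \<inter> prime_inter n G' = prime_inter n (G \<union> G')"
  by (auto simp: prime_inter_def)

section \<open>Knutson ideals and their minimal primes\<close>

lemma gap_nonempty: "1 \<le> n \<Longrightarrow> ({0..n} - {g :: int}) \<inter> {0..n} \<noteq> {}"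
proof (cases "g = 0")
  case True
  assume "1 \<le> n"
  then have "1 \<in> ({0..n} - {g}) \<inter> {0..n}" using True by simp
  then show ?thesis by blast
next
  case False
  assume "1 \<le> n"
  then have "0 \<in> ({0..n} - {g}) \<inter> {0..n}" using False by simp
  then show ?thesis by blast
qed

text \<open>If all gaps except \<open>g\<close> are cut, then $g, g + 1$ are the only two indices in one
  block, so that prime is principal.\<close>

lemma block_prime_single_gap:
  fixes p :: "'k::field mpoly"
  assumes n: "1 \<le> n" and g: "g \<in> {0..n}" and p: "p \<in> block_prime {1..n} n {} ({0..n} - {g})"
  shows "\<exists>q \<in> carrier (poly_ring {1..n}). p = ext_minor n g (g + 1) * q"
proof -
  let ?J = "{ext_minor n g (g + 1) * q | q. q \<in> carrier (poly_ring {1..n})} :: 'k mpoly set"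
  have hc: "ext_minor n g (g + 1) \<in> carrier (poly_ring {1..n} :: 'k mpoly ring)"
    using g by (intro ext_minor_carrier) auto
  have "ideal ?J (poly_ring {1..n})"
  proof (rule ideal_poly_ringI)
    show "?J \<subseteq> carrier (poly_ring {1..n})" using hc carrier_poly_ring_closed(2) by blast
    show "0 \<in> ?J" using carrier_poly_ring_closed(4) by force
    show "p + q \<in> ?J" if pq: "p \<in> ?J" "q \<in> ?J" for p q
    proof -
      obtain a b where "p = ext_minor n g (g + 1) * a" "q = ext_minor n g (g + 1) * b"
        "a \<in> carrier (poly_ring {1..n})" "b \<in> carrier (poly_ring {1..n})" using pq by blast
      then have "p + q = ext_minor n g (g + 1) * (a + b)" "a + b \<in> carrier (poly_ring {1..n})"
        by (simp_all add: distrib_left carrier_poly_ring_closed)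
      then show ?thesis by blast
    qed
    show "q * p \<in> ?J" if pq: "p \<in> ?J" "q \<in> carrier (poly_ring {1..n})" for p q
    proof -
      obtain a where "p = ext_minor n g (g + 1) * a" "a \<in> carrier (poly_ring {1..n})" using pq by blast
      then have "q * p = ext_minor n g (g + 1) * (q * a)" "q * a \<in> carrier (poly_ring {1..n})"
        using pq by (simp_all add: mult.left_commute carrier_poly_ring_closed)
      then show ?thesis by blast
    qed
  qed
  moreover have "ext_minor n i j \<in> ?J"
    if "i \<in> insert 0 {1..n}" "j \<in> insert (n + 1) {1..n}" "i < j" "({0..n} - {g}) \<inter> {i..<j} = {}" for i j
  proof -
    have "x = g" if x: "x \<in> {i..<j}" for x
    proof (rule ccontr)
      assume "x \<noteq> g"
      then have "x \<in> ({0..n} - {g}) \<inter> {i..<j}"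
        using x \<open>i \<in> _\<close> \<open>j \<in> _\<close> by auto
      with \<open>({0..n} - {g}) \<inter> {i..<j} = {}\<close> show False by blast
    qed
    from this[of i] this[of "j - 1"] \<open>i < j\<close> have "i = g" "j = g + 1" by auto
    then show ?thesis using carrier_poly_ring_closed(5) by force
  qed
  ultimately have "contains_gens {1..n} n {} ({0..n} - {g}) ?J" by (auto simp: contains_gens_def)
  then show ?thesis using block_prime_least[OF order_refl gap_nonempty[OF n], of "{}" g ?J] n p by auto
qed

lemma knutson_f_prod:
  assumes "1 \<le> n"
  shows "(knutson_f n :: 'k::field mpoly) = (\<Prod>g\<in>{0..n}. ext_minor n g (g + 1))"
proof -
  have "{0..n} = insert 0 (insert n {1..<n})" using assms by auto
  moreover have "(\<Prod>i\<in>{1..<n}. ext_minor n i (i + 1)) = (\<Prod>i\<in>{1..<n}. minor i (i + 1) :: 'k mpoly)"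
    by (intro prod.cong) (auto simp: ext_minor_inner[OF order_refl])
  moreover have "ext_minor n 0 (0 + 1) = (yy 1 :: 'k mpoly)" "ext_minor n n (n + 1) = (xx n :: 'k mpoly)"
    using assms by (auto simp: ext_minor_def ext_x_def ext_y_def)
  ultimately show ?thesis using assms by (simp add: knutson_f_def mult.assoc mult.commute)
qed

lemma prime_prod_notin:
  assumes P: "primeideal P (poly_ring W :: 'k::field mpoly ring)" and "finite A"
    and f: "\<And>a. a \<in> A \<Longrightarrow> f a \<in> carrier (poly_ring W) - P"
  shows "(\<Prod>a\<in>A. f a) \<in> carrier (poly_ring W) - P"
  using \<open>finite A\<close> f
proof (induction A rule: finite_induct)
  case empty
  interpret primeideal P "poly_ring W :: 'k mpoly ring" by fact
  have "1 \<notin> P" using one_imp_carrier I_notcarr by auto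
  then show ?case by (simp add: carrier_poly_ring_closed)
next
  case (insert a A)
  then have "f a \<in> carrier (poly_ring W) - P" "(\<Prod>a\<in>A. f a) \<in> carrier (poly_ring W) - P" by auto
  then show ?case
    using insert.hyps primeideal.I_prime[OF P, of "f a" "\<Prod>a\<in>A. f a"]
    by (auto simp: carrier_poly_ring_closed)
qed

definition gap_data :: "int \<Rightarrow> (int set \<times> int set) set" where
  "gap_data n = (\<lambda>g. ({}, {0..n} - {g})) ` {0..n}"

lemma ext_minor_gap:
  assumes "1 \<le> n" "h \<in> {0..n}" "g \<in> {0..n}"
  shows "ext_minor n h (h + 1) \<in> block_prime {1..n} n {} ({0..n} - {g}) \<longleftrightarrow> h = g"
proof -
  have "ext_minor n h (h + 1) \<in> block_prime {1..n} n {} ({0..n} - {g}) \<longleftrightarrow> ({0..n} - {g}) \<inter> {h..<h + 1} = {}"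
    using assms gap_nonempty by (intro ext_minor_block_prime_iff) auto
  moreover have "{h..<h + 1} = {h}" by auto
  ultimately show ?thesis using assms by auto
qed

text \<open>The factors of $f$ generate pairwise distinct principal primes, so an element divisible by
  each of them is divisible by their product.\<close>

lemma prod_dvd_of_gaps:
  assumes n: "1 \<le> n" and "finite A" and "A \<subseteq> {0..n}"
    and "p \<in> carrier (poly_ring {1..n} :: 'k::field mpoly ring)"
    and "\<And>g. g \<in> A \<Longrightarrow> p \<in> block_prime {1..n} n {} ({0..n} - {g})"
  shows "\<exists>q \<in> carrier (poly_ring {1..n}). p = (\<Prod>g\<in>A. ext_minor n g (g + 1)) * q"
  using assms(2-)
proof (induction A rule: finite_induct)
  case empty
  then show ?case by auto
next
  case (insert g A)
  have P: "primeideal (block_prime {1..n} n {} ({0..n} - {g})) (poly_ring {1..n} :: 'k mpoly ring)"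
    by (rule primeideal_block_prime)
  obtain q where q: "q \<in> carrier (poly_ring {1..n})" "p = (\<Prod>g\<in>A. ext_minor n g (g + 1)) * q"
    using insert by auto
  have "(\<Prod>g\<in>A. ext_minor n g (g + 1)) \<in> carrier (poly_ring {1..n}) -
      (block_prime {1..n} n {} ({0..n} - {g}) :: 'k mpoly set)"
  proof (rule prime_prod_notin[OF P insert.hyps(1)])
    fix h assume "h \<in> A"
    then show "ext_minor n h (h + 1) \<in> carrier (poly_ring {1..n}) -
        (block_prime {1..n} n {} ({0..n} - {g}) :: 'k mpoly set)"
      using insert.prems(1) insert.hyps(2) ext_minor_gap[OF n, of h g] by (auto intro!: ext_minor_carrier)
  qed
  moreover have "p \<in> block_prime {1..n} n {} ({0..n} - {g})" using insert.prems by simp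
  ultimately have "q \<in> block_prime {1..n} n {} ({0..n} - {g})"
    using primeideal.I_prime[OF P, of "\<Prod>g\<in>A. ext_minor n g (g + 1)" q] q by auto
  then obtain r where "r \<in> carrier (poly_ring {1..n})" "q = ext_minor n g (g + 1) * r"
    using block_prime_single_gap[OF n, of g q] insert.prems(1) by auto
  then show ?case using q insert.hyps by (auto simp: mult.assoc mult.left_commute)
qed

lemma prod_ext_minor_carrier:
  assumes "A \<subseteq> {0..n}"
  shows "(\<Prod>g\<in>A. ext_minor n g (g + 1)) \<in> carrier (poly_ring {1..n} :: 'k::field mpoly ring)"
  using finite_subset[OF assms] assms
  by (induction A rule: infinite_finite_induct)
    (auto simp: carrier_poly_ring_closed intro!: carrier_poly_ring_closed(2) ext_minor_carrier)

lemma principal_prime_inter: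
  assumes n: "1 \<le> n"
  shows "Idl\<^bsub>poly_ring {1..n}\<^esub> {knutson_f n} = (prime_inter n (gap_data n) :: 'k::field mpoly set)"
proof
  interpret cring "poly_ring {1..n} :: 'k mpoly ring" by (rule cring_poly_ring)
  have fc: "knutson_f n \<in> carrier (poly_ring {1..n} :: 'k mpoly ring)"
    using prod_ext_minor_carrier[of "{0..n}" n] by (simp add: knutson_f_prod[OF n])
  show "Idl\<^bsub>poly_ring {1..n}\<^esub> {knutson_f n} \<subseteq> (prime_inter n (gap_data n) :: 'k mpoly set)"
  proof (rule genideal_minimal[OF ideal_prime_inter])
    have "(knutson_f n :: 'k mpoly) \<in> block_prime {1..n} n {} ({0..n} - {g})" if g: "g \<in> {0..n}" for g
    proof -
      have "(\<Prod>h\<in>{0..n} - {g}. ext_minor n h (h + 1)) * ext_minor n g (g + 1)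
          \<in> (block_prime {1..n} n {} ({0..n} - {g}) :: 'k mpoly set)"
        using ext_minor_gap[OF n g g] by (intro ideal_poly_ringD(4)[OF ideal_block_prime] prod_ext_minor_carrier) auto
      then show ?thesis
        unfolding knutson_f_prod[OF n] using prod.remove[OF _ g, of "\<lambda>h. ext_minor n h (h + 1) :: 'k mpoly"]
        by (simp add: mult.commute)
    qed
    then show "{knutson_f n} \<subseteq> (prime_inter n (gap_data n) :: 'k mpoly set)"
      using fc by (auto simp: prime_inter_def gap_data_def prime_of_def)
  qed
  show "prime_inter n (gap_data n) \<subseteq> Idl\<^bsub>poly_ring {1..n}\<^esub> {knutson_f n :: 'k mpoly}"
  proof
    fix p :: "'k mpoly" assume p: "p \<in> prime_inter n (gap_data n)"
    then obtain q where "q \<in> carrier (poly_ring {1..n})" "p = knutson_f n * q"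
      using prod_dvd_of_gaps[OF n, of "{0..n}" p]
      by (auto simp: prime_inter_def gap_data_def prime_of_def knutson_f_prod[OF n])
    moreover have "ideal (Idl\<^bsub>poly_ring {1..n}\<^esub> {knutson_f n :: 'k mpoly}) (poly_ring {1..n})"
      using fc by (intro genideal_ideal) auto
    moreover have "knutson_f n \<in> Idl\<^bsub>poly_ring {1..n}\<^esub> {knutson_f n :: 'k mpoly}"
      using fc by (intro genideal_self') auto
    ultimately show "p \<in> Idl\<^bsub>poly_ring {1..n}\<^esub> {knutson_f n :: 'k mpoly}"
      using ideal_poly_ringD(4) by (metis mult.commute)
  qed
qed

lemma knutson_ideal_prime_inter:
  assumes n: "1 \<le> n" and I: "I \<in> knutson_ideals (poly_ring {1..n}) (knutson_f n :: 'k::field mpoly)"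
  shows "\<exists>G \<subseteq> cut_data n. I = prime_inter n G"
  using I
proof (induction rule: knutson_ideals.induct)
  case principal
  have "gap_data n \<subseteq> cut_data n" using gap_nonempty[OF n] by (auto simp: gap_data_def cut_data_def)
  then show ?case using principal_prime_inter[OF n] by blast
next
  case (colon I J)
  then obtain G where "G \<subseteq> cut_data n" "I = prime_inter n G" by blast
  then show ?case using colon_prime_inter[OF colon.hyps(2), of G]
    by (intro exI[of _ "{x \<in> G. \<not> J \<subseteq> prime_of n x}"]) auto
next
  case (sum I J)
  then obtain G G' where "G \<subseteq> cut_data n" "I = prime_inter n G" "G' \<subseteq> cut_data n" "J = prime_inter n G'" by blast
  then have "ideal_sum I J = prime_inter n {x \<in> cut_data n. I \<subseteq> prime_of n x \<and> J \<subseteq> prime_of n x}"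
    using sum_prime_inter[of n G G'] n by simp
  then show ?case unfolding set_add_poly_ring
    by (intro exI[of _ "{x \<in> cut_data n. I \<subseteq> prime_of n x \<and> J \<subseteq> prime_of n x}"]) simp
next
  case (inter I J)
  then obtain G G' where "G \<subseteq> cut_data n" "I = prime_inter n G" "G' \<subseteq> cut_data n" "J = prime_inter n G'" by blast
  then show ?case unfolding Int_prime_inter using Int_prime_inter[of n G G'] by (intro exI[of _ "G \<union> G'"]) auto
qed

text \<open>If no prime of the family were contained in \<open>P\<close>, choose for every
  \<open>x\<close> in the family an element of its prime outside \<open>P\<close>: the
  product of these elements lies in the intersection but not in \<open>P\<close>.\<close>

lemma minimal_prime_prime_inter:
  assumes P: "P \<in> minimal_primes (poly_ring {1..n}) (prime_inter n G :: 'k::field mpoly set)"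
    and G: "G \<subseteq> cut_data n"
  shows "\<exists>x \<in> G. P = prime_of n x"
proof -
  have Pp: "primeideal P (poly_ring {1..n})" and sub: "prime_inter n G \<subseteq> P"
    and min: "\<And>Q. primeideal Q (poly_ring {1..n}) \<Longrightarrow> prime_inter n G \<subseteq> Q \<Longrightarrow> Q \<subseteq> P \<Longrightarrow> Q = P"
    using P by (auto simp: minimal_primes_def)
  have fin: "finite G" using finite_subset[OF G finite_cut_data] .
  have "\<exists>x\<in>G. prime_of n x \<subseteq> P"
  proof (rule ccontr)
    assume "\<not> ?thesis"
    then have "\<forall>x\<in>G. \<exists>p. p \<in> prime_of n x - P" by blast
    then obtain f where f: "\<And>x. x \<in> G \<Longrightarrow> f x \<in> prime_of n x - P" by metis
    then have fc: "f x \<in> carrier (poly_ring {1..n}) - P" if "x \<in> G" for x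
      using that ideal_poly_ringD(1)[OF ideal_prime_of] by blast
    have prod: "(\<Prod>x\<in>G. f x) \<in> carrier (poly_ring {1..n}) - P" by (rule prime_prod_notin[OF Pp fin fc])
    moreover have "(\<Prod>x\<in>G. f x) \<in> prime_of n x" if x: "x \<in> G" for x
    proof -
      have "(\<Prod>y\<in>G - {x}. f y) \<in> carrier (poly_ring {1..n}) - P"
        using fin fc by (intro prime_prod_notin[OF Pp]) auto
      then have "(\<Prod>y\<in>G - {x}. f y) * f x \<in> prime_of n x"
        using f[OF x] by (intro ideal_poly_ringD(4)[OF ideal_prime_of]) auto
      then show ?thesis using prod.remove[OF fin x, of f] by (simp add: mult.commute)
    qed
    ultimately show False using sub by (auto simp: prime_inter_def)
  qed
  then obtain x where x: "x \<in> G" "prime_of n x \<subseteq> P" by blast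
  moreover have "prime_inter n G \<subseteq> prime_of n x" using x by (auto simp: prime_inter_def)
  ultimately show ?thesis using min[OF primeideal_prime_of] by blast
qed

section \<open>Binomial edge ideals of weakly closed graphs\<close>

lemma Idl_least:
  "ideal J (poly_ring W) \<Longrightarrow> G \<subseteq> J \<Longrightarrow> Idl\<^bsub>poly_ring W\<^esub> G \<subseteq> J"
  by (rule ring.genideal_minimal[OF cring.axioms(1)[OF cring_poly_ring]])

lemma Idl_ideal: "G \<subseteq> carrier (poly_ring W) \<Longrightarrow> ideal (Idl\<^bsub>poly_ring W\<^esub> G) (poly_ring W)"
  by (rule ring.genideal_ideal[OF cring.axioms(1)[OF cring_poly_ring]]) simp

lemma Idl_upper: "G \<subseteq> carrier (poly_ring W) \<Longrightarrow> G \<subseteq> Idl\<^bsub>poly_ring W\<^esub> G"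
  by (rule ring.genideal_self[OF cring.axioms(1)[OF cring_poly_ring]]) simp

lemma carrier_mono: "V \<subseteq> W \<Longrightarrow> carrier (poly_ring V) \<subseteq> carrier (poly_ring W)"
  by (auto simp: poly_ring_def)

lemma minor_carrier: "i \<in> W \<Longrightarrow> j \<in> W \<Longrightarrow> minor i j \<in> carrier (poly_ring W)"
  unfolding minor_def by (intro carrier_poly_ring_closed xx_yy_in_poly_ring)

lemma minor_swap: "minor j i = - minor i j"
  by (simp add: minor_def)

lemma ideal_uminus: "ideal J (poly_ring W :: 'k::field mpoly ring) \<Longrightarrow> p \<in> J \<Longrightarrow> - p \<in> J"
  using ideal_poly_ringD(2,5)[of J W] by (metis diff_0)

text \<open>The data between the first cut $k - 1$ and the last cut $l$. The vertex set is enlarged by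
  $l + 1$ and $l + 2$, separated from all other indices by additional cuts; for $s \in S$ to
  be a cut vertex there must be at least two components that it connects, and the blocks in
  $\{k, \ldots, l\}$ need not provide them. The parameter \<open>ty\<close> merely fixes the
  coefficient field.\<close>

locale middle_part =
  fixes k l :: int and S D :: "int set" and ty :: "'k::field itself"
  assumes kl: "1 \<le> k" "k \<le> l + 1" and S: "S \<subseteq> {k..l}" and D: "D \<subseteq> {k - 1..l}" "k - 1 \<in> D" "l \<in> D"
begin

definition W where "W = {k..l + 2}"
definition D' where "D' = D \<union> {l + 1, l + 2}"
definition Q :: "'k mpoly set" where "Q = block_prime W (l + 2) S D'"
definition L :: "'k mpoly set" where "L = block_prime {k..l} (l + 2) S D'"
text \<open>All edges allowed by the prime \<open>Q\<close>: the pairs whose minor lies in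
  \<open>Q\<close> (\<open>minor_in_Q_iff\<close>).\<close>

definition E where "E = {{i, j} | i j. i \<in> W \<and> j \<in> W \<and> i < j \<and> (i \<in> S \<or> j \<in> S \<or> D' \<inter> {i..<j} = {})}"

lemma W: "W \<subseteq> {1..l + 2}" "S \<subseteq> W" "{k..l} \<subseteq> W" "l + 1 \<in> W" "l + 2 \<in> W" "l + 1 \<notin> S" "l + 2 \<notin> S"
  using kl S by (auto simp: W_def)

lemma D': "D' \<inter> {0..l + 2} \<noteq> {}" "0 \<le> l + 2"
  using kl by (auto simp: D'_def)

lemma Q_ideal: "ideal Q (poly_ring W)" and Q_prime: "primeideal Q (poly_ring W)"
  by (simp_all add: Q_def ideal_block_prime primeideal_block_prime)

lemma Q_gens: "contains_gens W (l + 2) S D' Q"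
  unfolding Q_def by (rule contains_gens_block_prime[OF W(1) D'])

lemma Q_vars: "s \<in> S \<Longrightarrow> xx s \<in> Q" "s \<in> S \<Longrightarrow> yy s \<in> Q"
  using Q_gens W by (auto simp: contains_gens_def)

lemma minor_in_Q_iff:
  assumes "i \<in> W" "j \<in> W" "i < j"
  shows "minor i j \<in> Q \<longleftrightarrow> i \<in> S \<or> j \<in> S \<or> D' \<inter> {i..<j} = {}"
proof (cases "i \<in> S \<or> j \<in> S")
  case True
  have "ext_minor (l + 2) i j \<in> Q"
    using Q_gens True assms by (intro ext_minor_killed[OF W(1) Q_ideal, of S]) (auto simp: contains_gens_def)
  then have "minor i j \<in> Q" using assms by (simp add: ext_minor_inner[OF W(1)])
  then show ?thesis using True by blast
next
  case False
  then show ?thesis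
    using ext_minor_block_prime_iff[OF W(1) D', of i S j] assms
    by (auto simp: Q_def ext_minor_inner[OF W(1)])
qed

text \<open>Since $k - 1$ and $l + 2$ are cuts, no index of \<open>W\<close> shares a block with a
  constant point.\<close>

lemma Q_least:
  assumes J: "ideal J (poly_ring W)" and "\<And>s. s \<in> S \<Longrightarrow> xx s \<in> J \<and> yy s \<in> J"
    and minors: "\<And>i j. i \<in> W - S \<Longrightarrow> j \<in> W - S \<Longrightarrow> i < j \<Longrightarrow> D' \<inter> {i..<j} = {} \<Longrightarrow> minor i j \<in> J"
  shows "Q \<subseteq> J"
  unfolding Q_def
proof (rule block_prime_least[OF W(1) D'])
  have "ext_minor (l + 2) i j \<in> J" if ij: "i \<in> insert 0 (W - S)" "j \<in> insert (l + 2 + 1) (W - S)" "i < j"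
    "D' \<inter> {i..<j} = {}" for i j
  proof -
    have "k - 1 \<in> D'" "l + 2 \<in> D'" using D by (auto simp: D'_def)
    with ij(4) have out: "k - 1 \<notin> {i..<j}" "l + 2 \<notin> {i..<j}" by blast+
    have "i \<noteq> 0"
    proof
      assume "i = 0"
      moreover have "k - 1 < j" using ij(2) kl by (auto simp: W_def)
      ultimately show False using out(1) kl by simp
    qed
    then have i: "i \<in> W - S" using ij(1) by blast
    moreover have "j \<noteq> l + 2 + 1" using out(2) i by (auto simp: W_def)
    ultimately show ?thesis using ij minors by (simp add: ext_minor_inner[OF W(1)])
  qed
  then show "contains_gens W (l + 2) S D' J" using assms by (auto simp: contains_gens_def)
qed

lemma L_subset_Q: "L \<subseteq> Q"
  using carrier_mono[OF W(3)] by (auto simp: L_def Q_def block_prime_def)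

lemma L_gens: "s \<in> S \<Longrightarrow> xx s \<in> L \<and> yy s \<in> L"
  "i \<in> {k..l} \<Longrightarrow> j \<in> {k..l} \<Longrightarrow> i < j \<Longrightarrow> D' \<inter> {i..<j} = {} \<Longrightarrow> minor i j \<in> L"
proof -
  have L: "L = Q \<inter> carrier (poly_ring {k..l})"
    using carrier_mono[OF W(3)] by (auto simp: L_def Q_def block_prime_def)
  show "xx s \<in> L \<and> yy s \<in> L" if "s \<in> S"
    using that Q_vars S unfolding L by (auto simp: xx_yy_in_poly_ring)
  show "minor i j \<in> L" if "i \<in> {k..l}" "j \<in> {k..l}" "i < j" "D' \<inter> {i..<j} = {}"
  proof -
    have "i \<in> W" "j \<in> W" using that W(3) by blast+
    then have "minor i j \<in> Q" using minor_in_Q_iff that by blast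
    then show ?thesis using minor_carrier[OF that(1,2)] unfolding L by blast
  qed
qed

lemma same_ideal_L_Q: "same_ideal {k..l} L W Q"
proof -
  have un: "{k..l} \<union> W = W" using W(3) by blast
  have Lc: "L \<subseteq> carrier (poly_ring W)" using L_subset_Q ideal_poly_ringD(1)[OF Q_ideal] by blast
  have "Idl\<^bsub>poly_ring W\<^esub> Q = Q"
    using Idl_least[OF Q_ideal order_refl] Idl_upper[OF ideal_poly_ringD(1)[OF Q_ideal]] by blast
  moreover have "Idl\<^bsub>poly_ring W\<^esub> L = Q"
  proof
    show "Idl\<^bsub>poly_ring W\<^esub> L \<subseteq> Q" by (rule Idl_least[OF Q_ideal L_subset_Q])
    show "Q \<subseteq> Idl\<^bsub>poly_ring W\<^esub> L"
    proof (rule Q_least[OF Idl_ideal[OF Lc]])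
      show "xx s \<in> Idl\<^bsub>poly_ring W\<^esub> L \<and> yy s \<in> Idl\<^bsub>poly_ring W\<^esub> L" if "s \<in> S" for s
        using L_gens(1)[OF that] Idl_upper[OF Lc] by blast
      show "minor i j \<in> Idl\<^bsub>poly_ring W\<^esub> L" if ij: "i \<in> W - S" "j \<in> W - S" "i < j" "D' \<inter> {i..<j} = {}" for i j
      proof -
        have "l \<notin> {i..<j}" "l + 1 \<notin> {i..<j}" using ij(4) D by (auto simp: D'_def)
        then have "j \<le> l" using ij by (auto simp: W_def)
        then show ?thesis using L_gens(2)[of i j] ij Idl_upper[OF Lc] by (auto simp: W_def)
      qed
    qed
  qed
  ultimately show ?thesis by (simp add: same_ideal_def un)
qed

lemma edge_iff:
  assumes "i < j"
  shows "{i, j} \<in> E \<longleftrightarrow> i \<in> W \<and> j \<in> W \<and> (i \<in> S \<or> j \<in> S \<or> D' \<inter> {i..<j} = {})"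
  using assms by (auto simp: E_def doubleton_eq_iff)

lemma simple_graph_E: "simple_graph W E"
  by (auto simp: simple_graph_def complete_edges_def E_def W_def)

text \<open>The natural order is a suitable labelling: an edge exists because an end is in
  \<open>S\<close>, and then this end is adjacent to every vertex, or because no cut lies
  between its ends, and then none lies between either end and a vertex in the middle.\<close>

lemma weakly_closed_E: "weakly_closed W E"
  unfolding weakly_closed_def
proof (intro exI conjI ballI impI)
  let ?lab = "\<lambda>v. nat (v - k + 1)"
  have "card W = nat (l + 3 - k)" by (simp add: W_def)
  then show "bij_betw ?lab W {1..card W}"
    using kl by (intro bij_betw_byWitness[where f' = "\<lambda>a. int a + k - 1"]) (auto simp: W_def)
  fix u v w assume uvw: "u \<in> W" "v \<in> W" "w \<in> W" "?lab u < ?lab v \<and> ?lab v < ?lab w \<and> {u, w} \<in> E"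
  then have "u < v" "v < w" by auto
  moreover from this have "D' \<inter> {u..<v} \<subseteq> D' \<inter> {u..<w}" by auto
  ultimately show "{u, v} \<in> E \<or> {v, w} \<in> E" using uvw by (auto simp: edge_iff)
qed

lemma edge_minors_in_Q: "binomial_edge_ideal W E \<subseteq> Q"
  unfolding binomial_edge_ideal_def
proof (rule Idl_least[OF Q_ideal])
  show "{minor i j | i j. {i, j} \<in> E} \<subseteq> Q"
  proof clarify
    fix i j assume ij: "{i, j} \<in> E"
    then have "i < j \<or> j < i" by (auto simp: E_def doubleton_eq_iff)
    then show "minor i j \<in> Q"
    proof
      assume "i < j"
      then show ?thesis using ij edge_iff minor_in_Q_iff by blast
    next
      assume "j < i"
      then have "minor j i \<in> Q" using ij edge_iff[of j i] minor_in_Q_iff[of j i] by (simp add: insert_commute)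
      from ideal_uminus[OF Q_ideal this] show ?thesis by (simp add: minor_swap[of j i])
    qed
  qed
qed

lemma edge_gens_carrier: "{minor i j | i j. {i, j} \<in> E} \<subseteq> (carrier (poly_ring W) :: 'k mpoly set)"
  by (auto simp: E_def doubleton_eq_iff intro!: minor_carrier)

lemma minor_edge: "{i, j} \<in> E \<Longrightarrow> (minor i j :: 'k mpoly) \<in> binomial_edge_ideal W E"
  unfolding binomial_edge_ideal_def using Idl_upper[OF edge_gens_carrier] by blast

text \<open>By the Pluecker relation $x_s F_{l+1,l+2} = x_{l+1} F_{s,l+2} - x_{l+2} F_{s,l+1}$, and the
  same for $y_s$, a prime containing the edge ideal contains $x_s F_{l+1,l+2}$ and $y_s
  F_{l+1,l+2}$ for $s \in S$. If it is contained in \<open>Q\<close>, then it does not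
  contain $F_{l+1,l+2}$, hence it contains $x_s$ and $y_s$.\<close>

lemma Q_minimal_prime: "Q \<in> minimal_primes (poly_ring W) (binomial_edge_ideal W E)"
  unfolding minimal_primes_def
proof (intro CollectI conjI allI impI Q_prime edge_minors_in_Q)
  fix P assume P: "primeideal P (poly_ring W) \<and> binomial_edge_ideal W E \<subseteq> P \<and> P \<subseteq> Q"
  have I: "ideal P (poly_ring W)" using P primeideal.axioms(1) by blast
  have notin: "minor (l + 1) (l + 2) \<notin> Q"
    using minor_in_Q_iff[of "l + 1" "l + 2"] W by (auto simp: D'_def)
  have xy: "xx s \<in> P \<and> yy s \<in> P" if s: "s \<in> S" for s
  proof -
    have sW: "s \<in> W" "s < l + 1" using s W S by auto
    then have "minor s (l + 1) \<in> P" "minor s (l + 2) \<in> P"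
      using minor_edge[of s] edge_iff[of s] s W P by auto
    then have m: "z * minor s (l + 2) - w * minor s (l + 1) \<in> P"
      if "z \<in> carrier (poly_ring W)" "w \<in> carrier (poly_ring W)" for z w
      using that by (intro ideal_poly_ringD(5)[OF I] ideal_poly_ringD(4)[OF I])
    have "xx s * minor (l + 1) (l + 2) = (xx (l + 1) * minor s (l + 2) - xx (l + 2) * minor s (l + 1) :: 'k mpoly)"
      "yy s * minor (l + 1) (l + 2) = (yy (l + 1) * minor s (l + 2) - yy (l + 2) * minor s (l + 1) :: 'k mpoly)"
      by (simp_all add: minor_def algebra_simps)
    then have "xx s * minor (l + 1) (l + 2) \<in> P" "yy s * minor (l + 1) (l + 2) \<in> P"
      using m W by (simp_all add: xx_yy_in_poly_ring)
    then show ?thesis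
      using primeideal.I_prime[OF conjunct1[OF P], of "xx s" "minor (l + 1) (l + 2)"]
        primeideal.I_prime[OF conjunct1[OF P], of "yy s" "minor (l + 1) (l + 2)"] notin P sW W
      by (auto simp: xx_yy_in_poly_ring minor_carrier)
  qed
  have "Q \<subseteq> P"
  proof (rule Q_least[OF I xy])
    fix i j assume "i \<in> W - S" "j \<in> W - S" "i < j" "D' \<inter> {i..<j} = {}"
    then show "minor i j \<in> P" using minor_edge[of i j] edge_iff[of i j] P by blast
  qed
  then show "P = Q" using P by blast
qed

lemma min_prime_L: "min_prime_of_weakly_closed {k..l} L"
  unfolding min_prime_of_weakly_closed_def
  using simple_graph_E weakly_closed_E Q_minimal_prime same_ideal_L_Q unfolding W_def by blast

lemma component_subset: "C \<in> components_on A F \<Longrightarrow> C \<subseteq> A"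
  by (auto simp: components_on_def quotient_def)

text \<open>Away from \<open>S\<close> edges do not cross cuts, so the block label is constant along
  paths.\<close>

lemma component_cut_free:
  assumes C: "C \<in> components_on (W - S) E" and "i \<in> C" "j \<in> C" "i < j"
  shows "D' \<inter> {i..<j} = {}"
proof -
  let ?e = "{(u, v). u \<in> W - S \<and> v \<in> W - S \<and> {u, v} \<in> E}"
  have edge: "block D' u = block D' v" if "(u, v) \<in> ?e" for u v
  proof -
    have pos: "0 \<le> u" "0 \<le> v" using that W(1) by auto
    consider "u < v" | "v < u" | "u = v" by linarith
    then show ?thesis
    proof cases
      case 1
      then show ?thesis using that edge_iff[OF 1] block_eq_iff[of u v D'] pos by auto
    next
      case 2
      then show ?thesis using that edge_iff[OF 2] block_eq_iff[of v u D'] pos by (auto simp: insert_commute)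
    qed simp
  qed
  have path: "block D' u = block D' v" if "(u, v) \<in> ?e\<^sup>*" for u v
    using that by (induction rule: rtrancl_induct) (use edge in auto)
  from C obtain a where "C = {(u, v) \<in> (W - S) \<times> (W - S). (u, v) \<in> ?e\<^sup>*} `` {a}"
    unfolding components_on_def by (rule quotientE)
  then have "(a, i) \<in> ?e\<^sup>*" "(a, j) \<in> ?e\<^sup>*" using \<open>i \<in> C\<close> \<open>j \<in> C\<close> by blast+
  then have "block D' i = block D' j" using path[of a i] path[of a j] by simp
  moreover have "0 \<le> i" using component_subset[OF C] \<open>i \<in> C\<close> W(1) by auto
  ultimately show ?thesis using block_eq_iff[of i j D'] \<open>i < j\<close> by simp
qed

lemma component_exists:
  assumes "i \<in> W - S" "j \<in> W - S" "i < j" "D' \<inter> {i..<j} = {}"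
  shows "\<exists>C \<in> components_on (W - S) E. i \<in> C \<and> j \<in> C"
proof -
  let ?e = "{(u, v). u \<in> W - S \<and> v \<in> W - S \<and> {u, v} \<in> E}"
  let ?r = "{(u, v) \<in> (W - S) \<times> (W - S). (u, v) \<in> ?e\<^sup>*}"
  have "(i, j) \<in> ?e" using assms edge_iff[of i j] by simp
  then have "(i, j) \<in> ?e\<^sup>*" by (rule r_into_rtrancl)
  then have "(i, i) \<in> ?r" "(i, j) \<in> ?r" using assms(1,2) by simp_all
  then have "i \<in> ?r `` {i}" "j \<in> ?r `` {i}" by blast+
  moreover have "?r `` {i} \<in> components_on (W - S) E"
    unfolding components_on_def using assms(1) by (rule quotientI)
  ultimately show ?thesis by (intro bexI[of _ "?r `` {i}"] conjI)
qed

text \<open>Common to both descriptions of \<open>Q\<close> by components, by complete graphs and by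
  intervals of columns: all that matters is that the ideal of a component contains its
  minors and stays inside \<open>Q\<close>.\<close>

lemma Q_eq_Idl_components:
  assumes upper: "\<And>C. C \<in> components_on (W - S) E \<Longrightarrow> F C \<subseteq> Q"
    and lower: "\<And>C i j. C \<in> components_on (W - S) E \<Longrightarrow> i \<in> C \<Longrightarrow> j \<in> C \<Longrightarrow> i < j \<Longrightarrow> minor i j \<in> F C"
  shows "Idl\<^bsub>poly_ring W\<^esub> (xx ` S \<union> yy ` S \<union> (\<Union>C \<in> components_on (W - S) E. F C)) = Q"
    (is "Idl\<^bsub>_\<^esub> ?G = Q")
proof
  have G: "?G \<subseteq> Q" using upper Q_vars by blast
  then show "Idl\<^bsub>poly_ring W\<^esub> ?G \<subseteq> Q" by (rule Idl_least[OF Q_ideal])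
  have Gc: "?G \<subseteq> carrier (poly_ring W)" using G ideal_poly_ringD(1)[OF Q_ideal] by blast
  show "Q \<subseteq> Idl\<^bsub>poly_ring W\<^esub> ?G"
  proof (rule Q_least[OF Idl_ideal[OF Gc]])
    show "xx s \<in> Idl\<^bsub>poly_ring W\<^esub> ?G \<and> yy s \<in> Idl\<^bsub>poly_ring W\<^esub> ?G" if "s \<in> S" for s
      using that Idl_upper[OF Gc] by blast
    fix i j assume ij: "i \<in> W - S" "j \<in> W - S" "i < j" "D' \<inter> {i..<j} = {}"
    from component_exists[OF this] obtain C where "C \<in> components_on (W - S) E" "i \<in> C" "j \<in> C" by blast
    then have "minor i j \<in> ?G" using lower ij(3) by blast
    then show "minor i j \<in> Idl\<^bsub>poly_ring W\<^esub> ?G" using Idl_upper[OF Gc] by blast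
  qed
qed

lemma P_ideal_eq_Q: "P_ideal W E S = Q"
  unfolding P_ideal_def
proof (rule Q_eq_Idl_components)
  fix C assume C: "C \<in> components_on (W - S) E"
  let ?G = "{minor i j | i j. {i, j} \<in> complete_edges C} :: 'k mpoly set"
  have CW: "C \<subseteq> W" using component_subset[OF C] by blast
  have minor_Q: "minor i j \<in> Q" if "i \<in> C" "j \<in> C" "i < j" for i j
    using component_cut_free[OF C that] minor_in_Q_iff[of i j] CW that by blast
  have GQ: "?G \<subseteq> Q"
  proof clarify
    fix i j assume "{i, j} \<in> complete_edges C"
    then have ij: "i \<in> C" "j \<in> C" "i < j \<or> j < i" by (auto simp: complete_edges_def card_2_iff doubleton_eq_iff)
    from ij(3) show "minor i j \<in> Q"
    proof
      assume "j < i"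
      from ideal_uminus[OF Q_ideal minor_Q[OF ij(2,1) this]] show ?thesis by (simp add: minor_swap[of j i])
    qed (rule minor_Q[OF ij(1,2)])
  qed
  then show "binomial_edge_ideal W (complete_edges C) \<subseteq> Q"
    unfolding binomial_edge_ideal_def by (rule Idl_least[OF Q_ideal])
  have Gc: "?G \<subseteq> carrier (poly_ring W)" using GQ ideal_poly_ringD(1)[OF Q_ideal] by blast
  fix i j assume "i \<in> C" "j \<in> C" "i < j"
  then have "{i, j} \<in> complete_edges C" by (simp add: complete_edges_def)
  then have "(minor i j :: 'k mpoly) \<in> ?G" by blast
  then show "(minor i j :: 'k mpoly) \<in> binomial_edge_ideal W (complete_edges C)"
    unfolding binomial_edge_ideal_def using Idl_upper[OF Gc] by blast
qed

text \<open>The interval spanned by a component contains no cut, so all minors of its columns are in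
  \<open>Q\<close>, including those that involve columns from \<open>S\<close>.\<close>

lemma P_bar_ideal_eq_Q: "P_bar_ideal W E S = Q"
  unfolding P_bar_ideal_def
proof (rule Q_eq_Idl_components)
  fix C assume C: "C \<in> components_on (W - S) E"
  let ?G = "{minor i j | i j. Min C \<le> i \<and> i < j \<and> j \<le> Max C} :: 'k mpoly set"
  have CW: "C \<subseteq> W" using component_subset[OF C] by blast
  then have fin: "finite C" by (rule finite_subset) (simp add: W_def)
  have GQ: "?G \<subseteq> Q"
  proof clarify
    fix i j assume ij: "Min C \<le> i" "i < j" "j \<le> Max C"
    have ne: "C \<noteq> {}" using C by (auto simp: components_on_def quotient_def)
    then have MM: "Min C \<in> C" "Max C \<in> C" using fin by simp_all
    then have "Min C \<in> W" "Max C \<in> W" using CW by auto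
    then have "i \<in> W" "j \<in> W" using ij by (auto simp: W_def)
    moreover have "D' \<inter> {i..<j} = {}" using component_cut_free[OF C MM] ij by fastforce
    ultimately show "minor i j \<in> Q" using minor_in_Q_iff ij by blast
  qed
  then show "minors_ideal W (Min C) (Max C) \<subseteq> Q"
    unfolding minors_ideal_def by (rule Idl_least[OF Q_ideal])
  have Gc: "?G \<subseteq> carrier (poly_ring W)" using GQ ideal_poly_ringD(1)[OF Q_ideal] by blast
  fix i j assume "i \<in> C" "j \<in> C" "i < j"
  then have "Min C \<le> i" "i < j" "j \<le> Max C" using fin by simp_all
  then have "(minor i j :: 'k mpoly) \<in> ?G" by blast
  then show "(minor i j :: 'k mpoly) \<in> minors_ideal W (Min C) (Max C)"
    unfolding minors_ideal_def using Idl_upper[OF Gc] by blast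
qed

lemma equals_own_bar_L: "equals_own_bar {k..l} L"
  unfolding equals_own_bar_def
  using simple_graph_E W(2) same_ideal_L_Q P_ideal_eq_Q P_bar_ideal_eq_Q unfolding W_def by metis

end

section \<open>Minimal primes of Knutson ideals\<close>

text \<open>Every pair $i < j$ in one block lies before the first cut, between the first and the last
  cut, or after the last cut. The minor $F_{ij}$ is then accounted for by the variables
  $y_i$ on the left, by \<open>M\<close>, or by the variables $x_i$ on the right.\<close>

lemma prime_of_decomposition:
  fixes n :: int
  assumes cd: "(S, D) \<in> cut_data n"
  defines "k \<equiv> Min D + 1" and "l \<equiv> Max D"
  defines "M \<equiv> block_prime {k..l} (l + 2) (S \<inter> {k..l}) (D \<union> {l + 1, l + 2}) :: 'k::field mpoly set"
  shows "block_prime {1..n} n S D =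
    ideal_sum (ideal_sum (ideal_sum (Idl\<^bsub>poly_ring {1..n}\<^esub> (yy ` {1..k - 1}))
        (Idl\<^bsub>poly_ring {1..n}\<^esub> (xx ` (S \<inter> {1..k - 1})))) (Idl\<^bsub>poly_ring {1..n}\<^esub> M))
      (ideal_sum (Idl\<^bsub>poly_ring {1..n}\<^esub> (xx ` {l + 1..n}))
        (Idl\<^bsub>poly_ring {1..n}\<^esub> (yy ` (S \<inter> {l + 1..n}))))"
    (is "?P = ideal_sum (ideal_sum (ideal_sum (?I ?A) (?I ?B)) (?I M)) (ideal_sum (?I ?X) (?I ?Y))"
      is "_ = ?RHS")
    and "1 \<le> k" "k \<le> l + 1" "l + 1 \<le> n + 1"
    "min_prime_of_weakly_closed {k..l} M" "equals_own_bar {k..l} M"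
proof -
  have cutS: "S \<subseteq> {1..n}" and cutD: "D \<subseteq> {0..n}" "D \<noteq> {}" using cd by (auto simp: cut_data_def)
  have finD: "finite D" using cutD(1) finite_subset by blast
  have memD: "k - 1 \<in> D" "l \<in> D" using finD cutD(2) by (simp_all add: k_def l_def)
  have rangeD: "D \<subseteq> {k - 1..l}" using finD by (auto simp: k_def l_def)
  show bounds: "1 \<le> k" "k \<le> l + 1" "l + 1 \<le> n + 1" using memD rangeD cutD(1) by auto
  interpret middle_part k l "S \<inter> {k..l}" D "TYPE('k)"
    by unfold_locales (use bounds memD rangeD in auto)
  have M_eq_L: "M = L" by (simp add: M_def L_def D'_def)
  show "min_prime_of_weakly_closed {k..l} M" "equals_own_bar {k..l} M"
    unfolding M_eq_L by (rule min_prime_L, rule equals_own_bar_L)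
  have D0: "D \<inter> {0..n} \<noteq> {}" "0 \<le> n"
    using cutD bounds by (simp_all add: Int_absorb2)
  have sub: "{k..l} \<subseteq> {1..n}" using bounds by auto
  have P: "ideal ?P (poly_ring {1..n} :: 'k mpoly ring)" by (rule ideal_block_prime)
  have M_restrict: "M \<subseteq> block_prime {k..l} n S D"
    unfolding M_def D'_def[symmetric]
  proof (rule block_prime_least[OF _ D'])
    show "{k..l} \<subseteq> {1..l + 2}" using bounds by auto
    have g: "contains_gens {k..l} n S D (block_prime {k..l} n S D :: 'k mpoly set)"
      by (rule contains_gens_block_prime[OF sub D0])
    have "(ext_minor (l + 2) i j :: 'k mpoly) \<in> block_prime {k..l} n S D"
      if ij: "i \<in> insert 0 ({k..l} - S)" "j \<in> insert (l + 2 + 1) ({k..l} - S)" "i < j" "D' \<inter> {i..<j} = {}" for i j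
    proof -
      have out: "k - 1 \<notin> {i..<j}" "l \<notin> {i..<j}" using ij(4) memD by (auto simp: D'_def)
      have D_empty: "D \<inter> {i..<j} = {}" using ij(4) by (auto simp: D'_def)
      have i: "i \<in> {k..l} - S" using ij(1,2) out(1) bounds by auto
      moreover have j: "j \<in> {k..l} - S" using ij(2) out(2) i by auto
      ultimately have "(ext_minor n i j :: 'k mpoly) \<in> block_prime {k..l} n S D"
        using g ij(3) D_empty unfolding contains_gens_def by blast
      then show ?thesis using i j sub bounds by (simp add: ext_minor_inner[of "{k..l}"])
    qed
    note hm = this
    have eqs: "S \<inter> {k..l} \<inter> {k..l} = S \<inter> {k..l}" "{k..l} - S \<inter> {k..l} = {k..l} - S" by auto
    have "ideal (block_prime {k..l} n S D :: 'k mpoly set) (poly_ring {k..l})"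
      "\<forall>s\<in>S \<inter> {k..l}. (xx s :: 'k mpoly) \<in> block_prime {k..l} n S D \<and>
         (yy s :: 'k mpoly) \<in> block_prime {k..l} n S D"
      using g unfolding contains_gens_def by blast+
    then show "contains_gens {k..l} (l + 2) (S \<inter> {k..l}) D' (block_prime {k..l} n S D :: 'k mpoly set)"
      unfolding contains_gens_def eqs by (intro conjI ballI impI hm) auto
  qed
  have MP: "M \<subseteq> ?P"
    using M_restrict carrier_mono[OF sub] by (auto simp: block_prime_def)
  have AP: "?A \<subseteq> ?P"
  proof
    fix p assume "p \<in> ?A"
    then obtain i where i: "i \<in> {1..k - 1}" "p = yy i" by blast
    then have "D \<inter> {0..<i} = {}" using rangeD by auto
    then show "p \<in> ?P" using i bounds by (simp add: yy_block_prime killed_vars_def)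
  qed
  have XP: "?X \<subseteq> ?P"
  proof
    fix p assume "p \<in> ?X"
    then obtain i where i: "i \<in> {l + 1..n}" "p = xx i" by blast
    then have "D \<inter> {i..n} = {}" using rangeD by auto
    then show "p \<in> ?P" using i bounds by (simp add: xx_block_prime killed_vars_def)
  qed
  have BP: "?B \<subseteq> ?P" and YP: "?Y \<subseteq> ?P"
    using cutS by (auto simp: xx_block_prime yy_block_prime killed_vars_def subset_iff)
  note Pc = ideal_poly_ringD(1)[OF P]
  have c: "?A \<subseteq> carrier (poly_ring {1..n})" "?B \<subseteq> carrier (poly_ring {1..n})"
    "M \<subseteq> carrier (poly_ring {1..n})" "?X \<subseteq> carrier (poly_ring {1..n})" "?Y \<subseteq> carrier (poly_ring {1..n})"
    using AP BP MP XP YP Pc by auto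
  note idl = Idl_ideal[OF c(1)] Idl_ideal[OF c(2)] Idl_ideal[OF c(3)] Idl_ideal[OF c(4)] Idl_ideal[OF c(5)]
  note s1 = ideal_ideal_sum[OF idl(1,2)]
  note s2 = ideal_ideal_sum[OF s1 idl(3)]
  note s3 = ideal_ideal_sum[OF idl(4,5)]
  define Z where "Z = ?RHS"
  have RHS: "ideal Z (poly_ring {1..n})" unfolding Z_def by (rule ideal_ideal_sum[OF s2 s3])
  have up: "?A \<subseteq> Z" "?B \<subseteq> Z" "M \<subseteq> Z" "?X \<subseteq> Z" "?Y \<subseteq> Z"
    unfolding Z_def using Idl_upper[OF c(1)] Idl_upper[OF c(2)] Idl_upper[OF c(3)] Idl_upper[OF c(4)] Idl_upper[OF c(5)]
      ideal_sum_upper[OF idl(1,2)] ideal_sum_upper[OF s1 idl(3)] ideal_sum_upper[OF idl(4,5)]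
      ideal_sum_upper[OF s2 s3] by (meson order_trans)+
  have "?P = Z"
  proof
    show "Z \<subseteq> ?P"
      unfolding Z_def using AP BP MP XP YP by (intro ideal_sum_least[OF P] Idl_least[OF P])
    show "?P \<subseteq> Z"
    proof (rule block_prime_least[OF order_refl D0])
      have vars: "xx s \<in> Z \<and> yy s \<in> Z" if s: "s \<in> S" for s
      proof -
        consider "s \<in> S \<inter> {1..k - 1}" | "s \<in> S \<inter> {k..l}" | "s \<in> S \<inter> {l + 1..n}"
          using s cutS by force
        then show ?thesis
        proof cases
          case 1
          then have "xx s \<in> ?B" "yy s \<in> ?A" by auto
          then show ?thesis using subsetD[OF up(2)] subsetD[OF up(1)] by simp
        next
          case 2
          from L_gens(1)[OF this] show ?thesis using subsetD[OF up(3)] by (simp add: M_eq_L)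
        next
          case 3
          then have "xx s \<in> ?X" "yy s \<in> ?Y" by auto
          then show ?thesis using subsetD[OF up(4)] subsetD[OF up(5)] by simp
        qed
      qed
      have hm: "ext_minor n i j \<in> Z"
        if ij: "i \<in> insert 0 ({1..n} - S)" "j \<in> insert (n + 1) ({1..n} - S)" "i < j" "D \<inter> {i..<j} = {}" for i j
      proof -
        have out: "k - 1 \<notin> {i..<j}" "l \<notin> {i..<j}" using ij(4) memD by blast+
        have "0 \<le> i \<and> i \<le> n" using ij(1) D0(2) by force
        moreover have "1 \<le> j \<and> j \<le> n + 1" using ij(2) D0(2) by force
        ultimately have range: "0 \<le> i" "i \<le> n" "1 \<le> j" "j \<le> n + 1" by simp_all
        have hc: "ext_x n i \<in> carrier (poly_ring {1..n} :: 'k mpoly ring)" "ext_x n j \<in> carrier (poly_ring {1..n} :: 'k mpoly ring)"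
          "ext_y n i \<in> carrier (poly_ring {1..n} :: 'k mpoly ring)" "ext_y n j \<in> carrier (poly_ring {1..n} :: 'k mpoly ring)"
          using range by (auto intro!: ext_x_carrier ext_y_carrier)
        consider "j \<le> k - 1" | "l < i" | "k \<le> i" "j \<le> l" using out ij(3) by force
        then show ?thesis
        proof cases
          case 1
          have y: "ext_y n t \<in> Z" if "0 \<le> t" "t \<le> k - 1" for t
            using that up(1) bounds ideal_poly_ringD(2)[OF RHS] by (cases "t = 0") (auto simp: ext_y_def)
          show ?thesis unfolding ext_minor_def
            using 1 range ij(3) hc by (intro ideal_poly_ringD(5)[OF RHS] ideal_poly_ringD(4)[OF RHS] y) auto
        next
          case 2
          have x: "ext_x n t \<in> Z" if "l < t" "t \<le> n + 1" for t
            using that up(4) bounds ideal_poly_ringD(2)[OF RHS] by (cases "t = n + 1") (auto simp: ext_x_def)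
          have "ext_y n j * ext_x n i - ext_y n i * ext_x n j \<in> Z"
            using 2 range ij(3) hc by (intro ideal_poly_ringD(5)[OF RHS] ideal_poly_ringD(4)[OF RHS] x) auto
          then show ?thesis by (simp add: ext_minor_def mult.commute)
        next
          case 3
          then have "D' \<inter> {i..<j} = {}" using ij(4) by (auto simp: D'_def)
          then have "minor i j \<in> Z" using L_gens(2)[of i j] 3 ij(3) up(3) unfolding M_eq_L by auto
          then show ?thesis using 3 bounds ij(3) by (simp add: ext_minor_inner[OF order_refl])
        qed
      qed
      show "contains_gens {1..n} n S D Z" using RHS vars hm by (auto simp: contains_gens_def)
    qed
  qed
  then show "?P = ?RHS" by (simp only: Z_def)
qed

theorem proposition4:
  fixes n :: int
    and R :: "('k::field) mpoly ring"
    and I P :: "'k mpoly set"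
  assumes n: "1 \<le> n"
    and R: "R = poly_ring {1..n}"
    and I: "I \<in> knutson_ideals R (knutson_f n)"
    and P: "P \<in> minimal_primes R I"
  shows "\<exists>k l U V L.
    1 \<le> k \<and> k \<le> l + 1 \<and> l + 1 \<le> n + 1 \<and>
    U \<subseteq> {1..k - 1} \<and> V \<subseteq> {l + 1..n} \<and>
    ideal L (poly_ring {k..l}) \<and>
    min_prime_of_weakly_closed {k..l} L \<and>
    equals_own_bar {k..l} L \<and>
    P = ((Idl\<^bsub>R\<^esub> (yy ` {1..k - 1}) <+>\<^bsub>R\<^esub> Idl\<^bsub>R\<^esub> (xx ` U))
          <+>\<^bsub>R\<^esub> Idl\<^bsub>R\<^esub> L)
          <+>\<^bsub>R\<^esub> (Idl\<^bsub>R\<^esub> (xx ` {l + 1..n}) <+>\<^bsub>R\<^esub> Idl\<^bsub>R\<^esub> (yy ` V))"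
proof -
  obtain G where G: "G \<subseteq> cut_data n" "I = prime_inter n G"
    using knutson_ideal_prime_inter[OF n] I unfolding R by blast
  obtain x where "x \<in> G" "P = prime_of n x"
    using minimal_prime_prime_inter[OF _ G(1)] P unfolding R G(2) by blast
  moreover obtain S D where "x = (S, D)" by (cases x)
  ultimately have cd: "(S, D) \<in> cut_data n" and P_eq: "P = block_prime {1..n} n S D"
    using G(1) by (auto simp: prime_of_def)
  note decomposition = prime_of_decomposition[OF cd]
  show ?thesis
    unfolding R set_add_poly_ring P_eq
    using decomposition(2-6)
    by (intro exI[of _ "Min D + 1"] exI[of _ "Max D"] exI[of _ "S \<inter> {1..Min D + 1 - 1}"]
        exI[of _ "S \<inter> {Max D + 1..n}"]
        exI[of _ "block_prime {Min D + 1..Max D} (Max D + 2) (S \<inter> {Min D + 1..Max D}) (D \<union> {Max D + 1, Max D + 2})"]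
        conjI decomposition(1) ideal_block_prime) auto
qed

end
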